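(* Let $G$ be an abelian-by-nilpotent group of type Bredon-$\mathrm{FP}_1$ with respect to the family of all virtually cyclic subgroups of $G$, such that for every element $g\in G$ of infinite order the centralizer $C_G(g)$ is finitely generated. Then $G$ is virtually cyclic.
   Context: $G$ is abelian-by-nilpotent if it has an abelian normal subgroup $A$ with $G/A$ nilpotent. A virtually cyclic group is one with a cyclic subgroup of finite index (finite groups are included). Let $\mathcal{VC}$ be the family of all virtually cyclic subgroups of $G$. The orbit category $\mathcal O_{\mathcal{VC}}G$ has as objects the transitive $G$-sets with stabilizers in $\mathcal{VC}$ and as morphisms the $G$-maps. An $\mathcal O_{\mathcal{VC}}G$-module is a contravariant functor from $\mathcal O_{\mathcal{VC}}G$ to abelian groups; exactness is defined pointwise. For a $G$-set $\Omega$ with stabilizers in $\mathcal{VC}$, $\mathbb Z[-,\Omega]$ is the $\mathcal O_{\mathcal{VC}}G$-module sending $\Delta$ to the free abelian group on the set of $G$-maps $\Delta\to\Omega$. A projective module is finitely generated if it is a direct summand of $\mathbb Z[-,\Omega]$ for some $\Omega$ with finitely many $G$-orbits and stabilizers in $\mathcal{VC}$. $G$ is of type Bredon-$\mathrm{FP}_n$ with respect to $\mathcal{VC}$ if the constant functor $\mathbb Z$ has a projective resolution $P_*$ over $\mathcal O_{\mathcal{VC}}G$ with $P_i$ finitely generated for all $i\le n$. *)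

theory Defs
  imports "HOL-Algebra.Algebra"
begin

section \<open>Groups\<close>

definition comm_elt :: "('a, 'b) monoid_scheme \<Rightarrow> 'a \<Rightarrow> 'a \<Rightarrow> 'a" where
  "comm_elt G x y = x \<otimes>\<^bsub>G\<^esub> y \<otimes>\<^bsub>G\<^esub> inv\<^bsub>G\<^esub> x \<otimes>\<^bsub>G\<^esub> inv\<^bsub>G\<^esub> y"

primrec lower_central :: "('a, 'b) monoid_scheme \<Rightarrow> nat \<Rightarrow> 'a set" where
  "lower_central G 0 = carrier G"
| "lower_central G (Suc n) =
     generate G {comm_elt G x y | x y. x \<in> carrier G \<and> y \<in> lower_central G n}"

definition nilpotent_group :: "('a, 'b) monoid_scheme \<Rightarrow> bool" where
  "nilpotent_group G \<longleftrightarrow> group G \<and> (\<exists>n. lower_central G n = {\<one>\<^bsub>G\<^esub>})"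

definition abelian_by_nilpotent :: "('a, 'b) monoid_scheme \<Rightarrow> bool" where
  "abelian_by_nilpotent G \<longleftrightarrow>
     (\<exists>A. A \<lhd> G \<and> comm_group (G\<lparr>carrier := A\<rparr>) \<and> nilpotent_group (G Mod A))"

definition virtually_cyclic :: "('a, 'b) monoid_scheme \<Rightarrow> bool" where
  "virtually_cyclic G \<longleftrightarrow> group G \<and>
     (\<exists>C. subgroup C G \<and> cyclic_group (G\<lparr>carrier := C\<rparr>) \<and> finite (rcosets\<^bsub>G\<^esub> C))"

definition VC :: "('a, 'b) monoid_scheme \<Rightarrow> 'a set set" where
  "VC G = {H. subgroup H G \<and> virtually_cyclic (G\<lparr>carrier := H\<rparr>)}"

definition centralizer :: "('a, 'b) monoid_scheme \<Rightarrow> 'a \<Rightarrow> 'a set" where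
  "centralizer G g = {x \<in> carrier G. x \<otimes>\<^bsub>G\<^esub> g = g \<otimes>\<^bsub>G\<^esub> x}"

definition fin_gen_subgroup :: "('a, 'b) monoid_scheme \<Rightarrow> 'a set \<Rightarrow> bool" where
  "fin_gen_subgroup G H \<longleftrightarrow> (\<exists>S. finite S \<and> S \<subseteq> H \<and> generate G S = H)"


section \<open>The orbit category\<close>

text \<open>A \<open>G\<close>-set is a pair of a carrier set and an action. The action is a homomorphism into
  the group of permutations of the carrier; its values outside \<open>carrier G\<close> are irrelevant.\<close>

type_synonym ('a, 'x) gset = "'x set \<times> ('a \<Rightarrow> 'x \<Rightarrow> 'x)"

definition gset_over ::
    "('a, 'b) monoid_scheme \<Rightarrow> 'a set set \<Rightarrow> ('a, 'x) gset \<Rightarrow> bool" where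
  "gset_over G \<F> \<Omega> \<longleftrightarrow> group_action G (fst \<Omega>) (snd \<Omega>) \<and>
     (\<forall>x\<in>fst \<Omega>. stabilizer G (snd \<Omega>) x \<in> \<F>)"

definition gmaps ::
    "('a, 'b) monoid_scheme \<Rightarrow> ('a, 'x) gset \<Rightarrow> ('a, 'y) gset \<Rightarrow> ('x \<Rightarrow> 'y) set" where
  "gmaps G \<Delta> \<Omega> = {f \<in> fst \<Delta> \<rightarrow>\<^sub>E fst \<Omega>.
     \<forall>g\<in>carrier G. \<forall>x\<in>fst \<Delta>. f (snd \<Delta> g x) = snd \<Omega> g (f x)}"

text \<open>Transitive \<open>G\<close>-sets are realised on sets of elements of type \<^typ>\<open>'a set\<close>. This type
  contains the cosets of every subgroup of \<open>G\<close>, so every transitive \<open>G\<close>-set is isomorphic to an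
  object. \<^locale>\<open>transitive_action\<close> admits the empty set, which is excluded here.\<close>

definition orb_objects ::
    "('a, 'b) monoid_scheme \<Rightarrow> 'a set set \<Rightarrow> ('a, 'a set) gset set" where
  "orb_objects G \<F> = {\<Delta>. fst \<Delta> \<noteq> {} \<and> transitive_action G (fst \<Delta>) (snd \<Delta>) \<and> gset_over G \<F> \<Delta>}"


section \<open>Modules over the orbit category\<close>

text \<open>\<open>ob M \<Delta>\<close> is the value of \<open>M\<close> at \<open>\<Delta>\<close>, and for \<open>f : \<Delta> \<rightarrow> \<Delta>'\<close> the induced homomorphism
  \<open>ob M \<Delta>' \<rightarrow> ob M \<Delta>\<close> is \<open>res M \<Delta> \<Delta>' f\<close>. Abelian groups are commutative groups in the sense of
  HOL-Algebra, hence written multiplicatively. All data are only relevant on objects, morphisms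
  and carriers.\<close>

record ('a, 'm) orb_module =
  ob :: "('a, 'a set) gset \<Rightarrow> 'm monoid"
  res :: "('a, 'a set) gset \<Rightarrow> ('a, 'a set) gset \<Rightarrow> ('a set \<Rightarrow> 'a set) \<Rightarrow> 'm \<Rightarrow> 'm"

definition is_orb_module ::
    "('a, 'b) monoid_scheme \<Rightarrow> 'a set set \<Rightarrow> ('a, 'm) orb_module \<Rightarrow> bool" where
  "is_orb_module G \<F> M \<longleftrightarrow>
     (\<forall>\<Delta>\<in>orb_objects G \<F>. comm_group (ob M \<Delta>)) \<and>
     (\<forall>\<Delta>\<in>orb_objects G \<F>. \<forall>\<Delta>'\<in>orb_objects G \<F>. \<forall>f\<in>gmaps G \<Delta> \<Delta>'.
        res M \<Delta> \<Delta>' f \<in> hom (ob M \<Delta>') (ob M \<Delta>)) \<and>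
     (\<forall>\<Delta>\<in>orb_objects G \<F>. \<forall>m\<in>carrier (ob M \<Delta>). res M \<Delta> \<Delta> (\<lambda>x\<in>fst \<Delta>. x) m = m) \<and>
     (\<forall>\<Delta>\<in>orb_objects G \<F>. \<forall>\<Delta>'\<in>orb_objects G \<F>. \<forall>\<Delta>''\<in>orb_objects G \<F>.
        \<forall>f\<in>gmaps G \<Delta> \<Delta>'. \<forall>f'\<in>gmaps G \<Delta>' \<Delta>''. \<forall>m\<in>carrier (ob M \<Delta>'').
        res M \<Delta> \<Delta>'' (compose (fst \<Delta>) f' f) m = res M \<Delta> \<Delta>' f (res M \<Delta>' \<Delta>'' f' m))"

definition orb_hom ::
    "('a, 'b) monoid_scheme \<Rightarrow> 'a set set \<Rightarrow> ('a, 'm) orb_module \<Rightarrow> ('a, 'k) orb_module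
     \<Rightarrow> (('a, 'a set) gset \<Rightarrow> 'm \<Rightarrow> 'k) set" where
  "orb_hom G \<F> M N = {\<eta>.
     (\<forall>\<Delta>\<in>orb_objects G \<F>. \<eta> \<Delta> \<in> hom (ob M \<Delta>) (ob N \<Delta>)) \<and>
     (\<forall>\<Delta>\<in>orb_objects G \<F>. \<forall>\<Delta>'\<in>orb_objects G \<F>. \<forall>f\<in>gmaps G \<Delta> \<Delta>'. \<forall>m\<in>carrier (ob M \<Delta>').
        \<eta> \<Delta> (res M \<Delta> \<Delta>' f m) = res N \<Delta> \<Delta>' f (\<eta> \<Delta>' m))}"

definition orb_epi ::
    "('a, 'b) monoid_scheme \<Rightarrow> 'a set set \<Rightarrow> ('a, 'm) orb_module \<Rightarrow> ('a, 'k) orb_module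
     \<Rightarrow> (('a, 'a set) gset \<Rightarrow> 'm \<Rightarrow> 'k) \<Rightarrow> bool" where
  "orb_epi G \<F> M N \<eta> \<longleftrightarrow> \<eta> \<in> orb_hom G \<F> M N \<and>
     (\<forall>\<Delta>\<in>orb_objects G \<F>. \<eta> \<Delta> ` carrier (ob M \<Delta>) = carrier (ob N \<Delta>))"

definition orb_exact_at ::
    "('a, 'b) monoid_scheme \<Rightarrow> 'a set set
     \<Rightarrow> ('a, 'l) orb_module \<Rightarrow> (('a, 'a set) gset \<Rightarrow> 'l \<Rightarrow> 'm)
     \<Rightarrow> ('a, 'm) orb_module \<Rightarrow> (('a, 'a set) gset \<Rightarrow> 'm \<Rightarrow> 'k) \<Rightarrow> ('a, 'k) orb_module \<Rightarrow> bool" where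
  "orb_exact_at G \<F> L \<eta> M \<theta> N \<longleftrightarrow>
     (\<forall>\<Delta>\<in>orb_objects G \<F>. \<eta> \<Delta> ` carrier (ob L \<Delta>) = kernel (ob M \<Delta>) (ob N \<Delta>) (\<theta> \<Delta>))"

definition orb_isomorphic ::
    "('a, 'b) monoid_scheme \<Rightarrow> 'a set set \<Rightarrow> ('a, 'm) orb_module \<Rightarrow> ('a, 'k) orb_module \<Rightarrow> bool" where
  "orb_isomorphic G \<F> M N \<longleftrightarrow>
     (\<exists>\<eta>\<in>orb_hom G \<F> M N. \<forall>\<Delta>\<in>orb_objects G \<F>. \<eta> \<Delta> \<in> iso (ob M \<Delta>) (ob N \<Delta>))"

definition orb_sum ::
    "('a, 'm) orb_module \<Rightarrow> ('a, 'k) orb_module \<Rightarrow> ('a, 'm \<times> 'k) orb_module" where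
  "orb_sum M N = \<lparr>ob = (\<lambda>\<Delta>. ob M \<Delta> \<times>\<times> ob N \<Delta>),
     res = (\<lambda>\<Delta> \<Delta>' f. map_prod (res M \<Delta> \<Delta>' f) (res N \<Delta> \<Delta>' f))\<rparr>"

definition const_Z :: "('a, int) orb_module" where
  "const_Z = \<lparr>ob = (\<lambda>_. integer_group), res = (\<lambda>_ _ _ m. m)\<rparr>"

definition free_orb_module ::
    "('a, 'b) monoid_scheme \<Rightarrow> ('a, 'x) gset \<Rightarrow> ('a, ('a set \<Rightarrow> 'x) \<Rightarrow>\<^sub>0 int) orb_module" where
  "free_orb_module G \<Omega> = \<lparr>ob = (\<lambda>\<Delta>. free_Abelian_group (gmaps G \<Delta> \<Omega>)),
     res = (\<lambda>\<Delta> \<Delta>' f. frag_extend (\<lambda>h. frag_of (compose (fst \<Delta>) h f)))\<rparr>"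


section \<open>Projective modules and finiteness conditions\<close>

text \<open>Quantification over modules needs a fixed type for their elements. The type \<open>'a univ\<close> is
  that of the elements of \<open>\<int>[-,\<Omega>]\<close> for \<open>\<Omega>\<close> a \<open>G\<close>-set on a subset of \<^typ>\<open>nat \<times> 'a set\<close>; every
  \<open>G\<close>-set with finitely many orbits has an isomorphic copy of this form. The type is infinite and
  has at least as many elements as there are morphisms between coset spaces of \<open>G\<close>. So each
  module with elements in \<open>'a univ\<close> is, up to isomorphism, a quotient of a free module with
  elements in \<open>'a univ\<close>, and lifting against epimorphisms within this type already gives
  projectivity with respect to all modules. For the same reason a resolution as in \<open>bredon_FP\<close>,
  but with elements in some other type, can be replaced by one with elements in \<open>'a univ\<close>.\<close>

type_synonym 'a univ = "('a set \<Rightarrow> nat \<times> 'a set) \<Rightarrow>\<^sub>0 int"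

definition orb_projective ::
    "('a, 'b) monoid_scheme \<Rightarrow> 'a set set \<Rightarrow> ('a, 'a univ) orb_module \<Rightarrow> bool" where
  "orb_projective G \<F> P \<longleftrightarrow> is_orb_module G \<F> P \<and>
     (\<forall>(M :: ('a, 'a univ) orb_module) (N :: ('a, 'a univ) orb_module) \<pi> \<theta>.
        is_orb_module G \<F> M \<longrightarrow> is_orb_module G \<F> N \<longrightarrow>
        orb_epi G \<F> M N \<pi> \<longrightarrow> \<theta> \<in> orb_hom G \<F> P N \<longrightarrow>
        (\<exists>\<theta>'\<in>orb_hom G \<F> P M. \<forall>\<Delta>\<in>orb_objects G \<F>. \<forall>p\<in>carrier (ob P \<Delta>).
           \<pi> \<Delta> (\<theta>' \<Delta> p) = \<theta> \<Delta> p))"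

definition fin_gen_projective ::
    "('a, 'b) monoid_scheme \<Rightarrow> 'a set set \<Rightarrow> ('a, 'a univ) orb_module \<Rightarrow> bool" where
  "fin_gen_projective G \<F> P \<longleftrightarrow> orb_projective G \<F> P \<and>
     (\<exists>(\<Omega> :: ('a, nat \<times> 'a set) gset) (Q :: ('a, 'a univ) orb_module).
        gset_over G \<F> \<Omega> \<and> finite (orbits G (fst \<Omega>) (snd \<Omega>)) \<and>
        is_orb_module G \<F> Q \<and> orb_isomorphic G \<F> (orb_sum P Q) (free_orb_module G \<Omega>))"

definition projective_resolution_Z ::
    "('a, 'b) monoid_scheme \<Rightarrow> 'a set set \<Rightarrow> (nat \<Rightarrow> ('a, 'a univ) orb_module)
     \<Rightarrow> (nat \<Rightarrow> ('a, 'a set) gset \<Rightarrow> 'a univ \<Rightarrow> 'a univ)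
     \<Rightarrow> (('a, 'a set) gset \<Rightarrow> 'a univ \<Rightarrow> int) \<Rightarrow> bool" where
  "projective_resolution_Z G \<F> P d \<epsilon> \<longleftrightarrow>
     (\<forall>i. orb_projective G \<F> (P i)) \<and>
     (\<forall>i. d i \<in> orb_hom G \<F> (P (Suc i)) (P i)) \<and>
     orb_epi G \<F> (P 0) const_Z \<epsilon> \<and>
     orb_exact_at G \<F> (P 1) (d 0) (P 0) \<epsilon> const_Z \<and>
     (\<forall>i. orb_exact_at G \<F> (P (i + 2)) (d (i + 1)) (P (i + 1)) (d i) (P i))"

definition bredon_FP :: "('a, 'b) monoid_scheme \<Rightarrow> 'a set set \<Rightarrow> nat \<Rightarrow> bool" where
  "bredon_FP G \<F> n \<longleftrightarrow>
     (\<exists>P d \<epsilon>. projective_resolution_Z G \<F> P d \<epsilon> \<and> (\<forall>i\<le>n. fin_gen_projective G \<F> (P i)))"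

end

theory Submission
  imports Defs
begin

text \<open>A finitely generated projective module that maps onto the constant functor \<open>\<int>\<close> is a summand
  of some \<open>\<int>[-,\<Omega>]\<close> with finitely many orbits in \<open>\<Omega>\<close>. Evaluating it at \<open>G/\<langle>x\<rangle>\<close> gives a \<open>G\<close>-map
  \<open>G/\<langle>x\<rangle> \<rightarrow> \<Omega>\<close>, so every \<open>x\<close> fixes a point of \<open>\<Omega>\<close>. Hence \<open>G\<close> is a union of conjugates of finitely
  many virtually cyclic subgroups (\<open>bredon_FP0_imp_vc_cover\<close>), and this property passes to
  quotients.

  It then suffices to go down a normal series with abelian factors: if \<open>A\<close> is an abelian normal
  subgroup and \<open>G/A\<close> is virtually cyclic, then so is \<open>G\<close> (\<open>abelian_extension_vc\<close>). The series
  consists of \<open>A\<close> and the preimages of the lower central series of \<open>G/A\<close>. If \<open>G/A\<close> is finite, then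
  \<open>A\<close> is a finite union of cosets of cyclic groups, and by B. H. Neumann's lemma one of these has
  finite index. Otherwise some \<open>t\<close> of infinite order modulo \<open>A\<close> generates a subgroup of finite
  index of \<open>G/A\<close>, and \<open>A\<close> is a module over \<open>\<int>[t,t\<^sup>-\<^sup>1]\<close> on which \<open>t\<close> acts by conjugation. It turns
  out to be finite:

  \<^item> A virtually cyclic group that meets a coset \<open>At\<^sup>k\<close> with \<open>k \<noteq> 0\<close> meets it in finitely many
    elements, and their number is bounded independently of \<open>k\<close>. On the other hand the conjugacy
    classes in \<open>At\<^sup>k\<close> under \<open>A\<langle>t\<rangle>\<close> correspond to the \<open>t\<close>-orbits on \<open>A/(t\<^sup>k - 1)A\<close>. Every finite
    quotient module of \<open>A\<close> is a quotient of \<open>A/(t\<^sup>k - 1)A\<close> for some \<open>k > 0\<close>, so it has boundedly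
    many orbits, hence bounded length. Therefore \<open>A\<close> has a minimal submodule \<open>N\<close> of finite index
    (\<open>minimal_cofinite_submodule\<close>).

  \<^item> \<open>N/nN\<close> has finitely many \<open>t\<close>-orbits and finite exponent, which forces it to be finite
    (\<open>finite_orbits_imp_finite_mod\<close>). By minimality \<open>N = nN\<close> for all \<open>n > 0\<close>, so \<open>N\<close> is divisible.

  \<^item> \<open>N\<close> is covered by the images under powers of \<open>t\<close> of finitely many groups of rank at most one.
    So its torsion has bounded exponent, and by divisibility \<open>N\<close> is torsion free. A nonzero \<open>x\<close> in
    \<open>N\<close> would be divisible by infinitely many primes inside a single orbit of lines; but the
    stabiliser of a line in \<open>\<langle>t\<rangle>\<close> is cyclic and acts on it by powers of one rational number, which
    involves only finitely many primes. So \<open>N = 0\<close> (\<open>divisible_imp_trivial\<close>).\<close>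

section \<open>Modules over the infinite cyclic group\<close>

lemma int_subgroup_principal:
  fixes D :: "int set"
  assumes zero: "0 \<in> D" and diff: "\<And>k l. k \<in> D \<Longrightarrow> l \<in> D \<Longrightarrow> k - l \<in> D"
  obtains s where "s \<in> D" "\<And>k. k \<in> D \<Longrightarrow> s dvd k"
proof (cases "D \<subseteq> {0}")
  case True
  then show ?thesis using that[of 0] zero by auto
next
  case False
  have neg: "- k \<in> D" if "k \<in> D" for k using diff[OF zero that] by simp
  have add: "k + l \<in> D" if "k \<in> D" "l \<in> D" for k l using diff[OF that(1) neg[OF that(2)]] by simp
  obtain k where "k \<in> D" "k \<noteq> 0" using False by auto
  then have "\<exists>n::nat. 0 < n \<and> int n \<in> D"
    using neg by (intro exI[of _ "nat \<bar>k\<bar>"]) (auto simp: abs_if)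
  then have ex: "\<exists>n. 0 < n \<and> int n \<in> D" .
  define n where "n = (LEAST n. 0 < n \<and> int n \<in> D)"
  have n: "0 < n" "int n \<in> D" using LeastI_ex[OF ex] by (auto simp: n_def)
  have least: "n \<le> m" if "0 < m" "int m \<in> D" for m
    unfolding n_def using that by (intro Least_le) auto
  have mult: "int n * j \<in> D" for j
  proof (induction j rule: int_induct[of _ 0])
    case (step1 i) then show ?case using add[OF n(2) step1(2)] by (simp add: algebra_simps)
  next
    case (step2 i) then show ?case using diff[OF _ n(2)] by (simp add: algebra_simps)
  qed (use zero in simp)
  have "int n dvd k" if "k \<in> D" for k
  proof -
    have "k mod int n \<in> D" using diff[OF that mult[of "k div int n"]] by (simp add: minus_mult_div_eq_mod)
    moreover have "0 \<le> k mod int n" "k mod int n < int n" using n(1) by auto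
    ultimately have "k mod int n = 0"
      using least[of "nat (k mod int n)"] by (cases "k mod int n = 0") auto
    then show ?thesis by auto
  qed
  then show ?thesis using that n(2) by blast
qed

text \<open>A \<open>\<int>[t,t\<^sup>-\<^sup>1]\<close>-module in multiplicative notation: \<open>T k\<close> is the action of \<open>t\<^sup>k\<close>.\<close>
locale int_module = comm_group A for A (structure) +
  fixes T :: "int \<Rightarrow> 'a \<Rightarrow> 'a"
  assumes T_hom: "T k \<in> hom A A"
    and T_zero: "x \<in> carrier A \<Longrightarrow> T 0 x = x"
    and T_add: "x \<in> carrier A \<Longrightarrow> T (k + l) x = T k (T l x)"
begin

lemma T_closed [simp, intro]: "x \<in> carrier A \<Longrightarrow> T k x \<in> carrier A"
  using T_hom by (auto simp: hom_def)

lemma T_mult: "x \<in> carrier A \<Longrightarrow> y \<in> carrier A \<Longrightarrow> T k (x \<otimes> y) = T k x \<otimes> T k y"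
  using T_hom by (auto simp: hom_def)

lemma T_group_hom: "group_hom A A (T k)"
  by (simp add: T_hom group_hom_axioms.intro group_hom_def is_group)

lemma T_one [simp]: "T k \<one> = \<one>"
  using group_hom.hom_one[OF T_group_hom] .

lemma T_inv: "x \<in> carrier A \<Longrightarrow> T k (inv x) = inv (T k x)"
  using group_hom.hom_inv[OF T_group_hom] by metis

lemma T_int_pow: "x \<in> carrier A \<Longrightarrow> T k (x [^] (z::int)) = T k x [^] z"
  using group_hom.hom_int_pow[OF T_group_hom] by metis

lemma T_nat_pow: "x \<in> carrier A \<Longrightarrow> T k (x [^] (n::nat)) = T k x [^] n"
  using T_int_pow[of x k "int n"] by (simp add: int_pow_int)

lemma T_cancel [simp]: "x \<in> carrier A \<Longrightarrow> T (- k) (T k x) = x" "x \<in> carrier A \<Longrightarrow> T k (T (- k) x) = x"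
  using T_add[of x "-k" k] T_add[of x k "-k"] T_zero[of x] by auto

definition submodule :: "'a set \<Rightarrow> bool" where
  "submodule B \<longleftrightarrow> subgroup B A \<and> (\<forall>k. \<forall>x\<in>B. T k x \<in> B)"

definition eqv :: "'a set \<Rightarrow> 'a \<Rightarrow> 'a \<Rightarrow> bool" where
  "eqv B x y \<longleftrightarrow> x \<in> carrier A \<and> y \<in> carrier A \<and> x \<otimes> inv y \<in> B"

text \<open>For a subgroup \<open>B\<close> of \<open>N\<close> this says that \<open>N/B\<close> is finite; no quotient group is formed.\<close>
definition finite_mod :: "'a set \<Rightarrow> 'a set \<Rightarrow> bool" where
  "finite_mod B N \<longleftrightarrow> (\<exists>F. finite F \<and> F \<subseteq> N \<and> (\<forall>x\<in>N. \<exists>f\<in>F. eqv B x f))"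

context
  fixes B
  assumes B: "subgroup B A"
begin

lemma eqv_refl: "x \<in> carrier A \<Longrightarrow> eqv B x x"
  using subgroup.one_closed[OF B] by (simp add: eqv_def)

lemma eqv_sym: "eqv B x y \<Longrightarrow> eqv B y x"
  using subgroup.m_inv_closed[OF B, of "x \<otimes> inv y"] by (auto simp: eqv_def inv_mult_group)

lemma eqv_mult:
  assumes "eqv B x y" "eqv B x' y'"
  shows "eqv B (x \<otimes> x') (y \<otimes> y')"
proof -
  have "(x \<otimes> x') \<otimes> inv (y \<otimes> y') = (x \<otimes> inv y) \<otimes> (x' \<otimes> inv y')"
    using assms by (simp add: eqv_def inv_mult m_ac)
  then show ?thesis using assms subgroup.m_closed[OF B] by (auto simp: eqv_def)
qed

lemma eqv_trans:
  assumes "eqv B x y" "eqv B y z"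
  shows "eqv B x z"
proof -
  have "x \<otimes> inv z = (x \<otimes> inv y) \<otimes> (y \<otimes> inv z)"
    using assms by (simp add: eqv_def m_assoc) (simp add: m_assoc[symmetric])
  then show ?thesis using assms subgroup.m_closed[OF B] by (auto simp: eqv_def)
qed

lemma eqv_mem: "eqv B x y \<Longrightarrow> subgroup N A \<Longrightarrow> B \<subseteq> N \<Longrightarrow> y \<in> N \<Longrightarrow> x \<in> N"
  using subgroup.m_closed[of N A "x \<otimes> inv y" y] by (auto simp: eqv_def m_assoc)

lemma eqv_one: "x \<in> B \<Longrightarrow> eqv B x \<one>"
  using subgroup.mem_carrier[OF B] by (simp add: eqv_def)

lemma finite_mod_pigeonhole:
  fixes h :: "nat \<Rightarrow> 'a"
  assumes fin: "finite_mod B N" and h: "\<And>n. h n \<in> N"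
  obtains i j where "i < j" "eqv B (h j) (h i)"
proof -
  obtain F where F: "finite F" "\<And>x. x \<in> N \<Longrightarrow> \<exists>f\<in>F. eqv B x f"
    using fin by (auto simp: finite_mod_def)
  obtain r where r: "\<And>n. r n \<in> F" "\<And>n. eqv B (h n) (r n)"
    using F(2)[OF h] by metis
  have "\<not> inj r"
    using finite_subset[of "range r" F] r(1) F(1) finite_imageD[of r UNIV] by auto
  then obtain i j where "r i = r j" "i < j"
    unfolding inj_def by (metis linorder_neqE_nat)
  then have "eqv B (h j) (h i)" using eqv_trans[OF r(2)[of j]] eqv_sym[OF r(2)[of i]] by simp
  with \<open>i < j\<close> show ?thesis using that by blast
qed

end

lemma submodule_subgroup: "submodule B \<Longrightarrow> subgroup B A"
  by (simp add: submodule_def)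

lemma submodule_carrier: "submodule (carrier A)"
  by (simp add: submodule_def subgroup_self)

lemma T_mem_iff: "submodule B \<Longrightarrow> x \<in> carrier A \<Longrightarrow> T k x \<in> B \<longleftrightarrow> x \<in> B"
  unfolding submodule_def by (metis T_cancel(1))

lemma eqv_T: "submodule B \<Longrightarrow> eqv B x y \<Longrightarrow> eqv B (T k x) (T k y)"
proof -
  assume h: "submodule B" "eqv B x y"
  then have "T k x \<otimes> inv (T k y) = T k (x \<otimes> inv y)" by (simp add: eqv_def T_mult T_inv)
  then show ?thesis using h by (simp add: eqv_def submodule_def)
qed

lemma eqv_T_diff:
  assumes "submodule B" "eqv B (T k x) (T l y)" "x \<in> carrier A" "y \<in> carrier A"
  shows "eqv B (T (k - l) x) y"
  using eqv_T[OF assms(1,2), of "- l"] assms(3,4) T_add[of x "-l" k] by simp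

lemma eqv_T_iterate:
  assumes B: "submodule B" and h: "eqv B (T p x) x" and x: "x \<in> carrier A"
  shows "eqv B (T (p * j) x) x"
proof (induction j rule: int_induct[of _ 0])
  case base
  then show ?case using x eqv_refl[OF submodule_subgroup[OF B]] T_zero by simp
next
  case (step1 i)
  have "T (p * (i + 1)) x = T (p * i) (T p x)" using T_add[OF x, of "p * i" p] by (simp add: algebra_simps)
  then show ?case
    using eqv_trans[OF submodule_subgroup[OF B] eqv_T[OF B h, of "p * i"] step1(2)] by simp
next
  case (step2 i)
  have "eqv B (T (p * i) x) (T p x)"
    using eqv_trans[OF submodule_subgroup[OF B] step2(2) eqv_sym[OF submodule_subgroup[OF B] h]] .
  from eqv_T_diff[OF B this x x] show ?case by (simp add: algebra_simps)
qed

text \<open>An automorphism of a finite group has finite order.\<close>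
lemma finite_mod_period:
  assumes B: "submodule B" and fin: "finite_mod B (carrier A)"
  obtains k :: int where "0 < k" "\<And>x. x \<in> carrier A \<Longrightarrow> eqv B (T k x) x"
proof -
  note sB = submodule_subgroup[OF B]
  obtain F where F: "finite F" "F \<subseteq> carrier A" "\<And>x. x \<in> carrier A \<Longrightarrow> \<exists>f\<in>F. eqv B x f"
    using fin by (auto simp: finite_mod_def)
  have "\<exists>q::int>0. eqv B (T q f) f" if "f \<in> F" for f
  proof -
    have f: "f \<in> carrier A" using that F(2) by auto
    obtain i j where ij: "i < j" "eqv B (T (int j) f) (T (int i) f)"
      using finite_mod_pigeonhole[OF sB fin, of "\<lambda>n. T (int n) f"] f by auto
    then show ?thesis using eqv_T_diff[OF B ij(2) f f] by (intro exI[of _ "int j - int i"]) auto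
  qed
  then obtain q where q: "\<And>f. f \<in> F \<Longrightarrow> 0 < q f \<and> eqv B (T (q f) f) f" by metis
  define k :: int where "k = (\<Prod>f\<in>F. q f)"
  have "0 < k" unfolding k_def using q by (intro prod_pos) auto
  moreover have "eqv B (T k x) x" if x: "x \<in> carrier A" for x
  proof -
    obtain f where f: "f \<in> F" "eqv B x f" using F(3)[OF x] by auto
    have "q f dvd k" unfolding k_def using f(1) F(1) by (simp add: dvd_prod_eqI)
    then obtain j where "k = q f * j" by auto
    then have "eqv B (T k f) f" using eqv_T_iterate[OF B, of "q f" f j] q[OF f(1)] f F(2) by auto
    then show ?thesis using eqv_T[OF B f(2), of k] eqv_trans[OF sB] eqv_sym[OF sB] f(2) by meson
  qed
  ultimately show ?thesis using that by blast
qed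

text \<open>The covering hypothesis says that \<open>t\<close> has at most \<open>card I\<close> orbits on \<open>A/(t\<^sup>k - 1)A\<close>. If \<open>t\<^sup>k\<close>
  acts trivially on the finite quotient \<open>A/C\<^sub>m\<close>, then \<open>C\<^sub>m\<close> contains \<open>(t\<^sup>k - 1)A\<close>. In a chain \<open>C\<^sub>0 \<supset> \<dots>
  \<supset> C\<^sub>m\<close> of submodules every layer \<open>C\<^sub>l - C\<^sub>l\<^sub>+\<^sub>1\<close> is a nonempty union of orbits modulo \<open>C\<^sub>m\<close>, so \<open>m\<close> is
  at most \<open>card I\<close>. Strictly descending chains of submodules of finite index are therefore
  finite.\<close>
lemma minimal_cofinite_submodule:
  fixes I :: "'i set"
  assumes I: "finite I"
    and cov: "\<And>k::int. 0 < k \<Longrightarrow> \<exists>\<sigma>. \<forall>a\<in>carrier A. \<exists>i\<in>I. \<sigma> i \<in> carrier A \<and>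
      (\<exists>j. \<exists>b\<in>carrier A. a = T j (\<sigma> i \<otimes> (b \<otimes> inv (T k b))))"
  obtains (minimal) N where "submodule N" "finite_mod N (carrier A)"
    "\<And>B. submodule B \<Longrightarrow> finite_mod B (carrier A) \<Longrightarrow> B \<subseteq> N \<Longrightarrow> B = N"
proof (rule ccontr)
  assume nothesis: "\<not> thesis"
  define Q where "Q B \<longleftrightarrow> submodule B \<and> finite_mod B (carrier A)" for B
  have step: "\<exists>B'. Q B' \<and> B' \<subset> B" if "Q B" for B
  proof (rule ccontr)
    assume "\<not> (\<exists>B'. Q B' \<and> B' \<subset> B)"
    then have thesis using that by (intro minimal[of B]) (auto simp: Q_def)
    with nothesis show False ..
  qed
  have "Q (carrier A)"
    unfolding Q_def finite_mod_def
    using submodule_carrier by (auto simp: eqv_def intro!: exI[of _ "{\<one>}"])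
  then obtain C where C: "\<And>n::nat. Q (C n)" "\<And>n. C (Suc n) \<subset> C n"
    using dependent_nat_choice[of "\<lambda>_. Q" "\<lambda>_ B B'. B' \<subset> B"] step by metis
  have Cm: "C m \<subseteq> C n" if "n \<le> m" for n m
    using lift_Suc_antimono_le[of C, OF _ that] C(2) by (meson psubset_imp_subset)
  define r where "r = card I"
  have Cr: "submodule (C (Suc r))" "finite_mod (C (Suc r)) (carrier A)" using C(1) Q_def by auto
  note sCr = submodule_subgroup[OF Cr(1)]
  obtain k where k: "0 < k" "\<And>x. x \<in> carrier A \<Longrightarrow> eqv (C (Suc r)) (T k x) x"
    using finite_mod_period[OF Cr] by metis
  obtain \<sigma> where \<sigma>: "\<And>a. a\<in>carrier A \<Longrightarrow> \<exists>i\<in>I. \<sigma> i \<in> carrier A \<and>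
      (\<exists>j. \<exists>b\<in>carrier A. a = T j (\<sigma> i \<otimes> (b \<otimes> inv (T k b))))"
    using cov[OF k(1)] by metis
  \<comment> \<open>Passing from \<open>\<sigma> i\<close> to \<open>a\<close> applies a power of \<open>t\<close> and an element of the last term of the
    chain; neither leaves a layer.\<close>
  have layer: "\<exists>i\<in>I. \<sigma> i \<in> C l \<and> \<sigma> i \<notin> C (Suc l)" if l: "l \<le> r" for l
  proof -
    obtain a where a: "a \<in> C l" "a \<notin> C (Suc l)" using C(2)[of l] by auto
    have sub: "submodule (C n)" "subgroup (C n) A" for n using C(1) Q_def submodule_subgroup by auto
    have "a \<in> carrier A" using a(1) subgroup.mem_carrier[OF sub(2)] by blast
    then obtain i j b where ib: "i \<in> I" "\<sigma> i \<in> carrier A" "b \<in> carrier A"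
      "a = T j (\<sigma> i \<otimes> (b \<otimes> inv (T k b)))" using \<sigma> by blast
    have bb: "b \<otimes> inv (T k b) \<in> C (Suc r)"
      using eqv_sym[OF sCr k(2)[OF ib(3)]] by (simp add: eqv_def)
    have iff: "a \<in> C n \<longleftrightarrow> \<sigma> i \<in> C n" if "n \<le> Suc r" for n
    proof -
      let ?d = "b \<otimes> inv (T k b)"
      have d: "?d \<in> C n" "?d \<in> carrier A" using bb Cm[OF that] ib(3) by auto
      have "a \<in> C n \<longleftrightarrow> \<sigma> i \<otimes> ?d \<in> C n" using T_mem_iff[OF sub(1)[of n], of "\<sigma> i \<otimes> ?d" j] ib d by simp
      also have "\<dots> \<longleftrightarrow> \<sigma> i \<in> C n"
        using subgroup.m_closed[OF sub(2)[of n], of "\<sigma> i" ?d]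
          subgroup.m_closed[OF sub(2)[of n], of "\<sigma> i \<otimes> ?d" "inv ?d"]
          subgroup.m_inv_closed[OF sub(2)[of n] d(1)] ib(2) d r_inv[of ?d] m_assoc[of "\<sigma> i" ?d "inv ?d"]
        by (metis inv_closed r_one)
      finally show ?thesis .
    qed
    show ?thesis using iff[of l] iff[of "Suc l"] a l ib(1) by auto
  qed
  then obtain p where p: "\<And>l. l \<le> r \<Longrightarrow> p l \<in> I \<and> \<sigma> (p l) \<in> C l \<and> \<sigma> (p l) \<notin> C (Suc l)" by metis
  have ne: "p l \<noteq> p m" if "l < m" "m \<le> r" for l m
    using p[of l] p[of m] Cm[of "Suc l" m] that by auto
  have "inj_on p {..r}"
    by (rule inj_onI) (metis ne atMost_iff linorder_neqE_nat)
  then have "card {..r} \<le> card I" using p I by (intro card_inj_on_le[of p]) auto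
  then show False by (simp add: r_def)
qed

text \<open>The subgroup generated by \<open>B\<close> and \<open>x, T 1 x, \<dots>, T (q - 1) x\<close>. If \<open>x\<close> lies in a submodule of
  finite exponent modulo \<open>B\<close>, it is finite modulo \<open>B\<close>; it is closed under \<open>t\<close> as soon as it
  contains \<open>T q x\<close>.\<close>
primrec cyc_span :: "'a set \<Rightarrow> 'a \<Rightarrow> nat \<Rightarrow> 'a set" where
  "cyc_span B x 0 = B"
| "cyc_span B x (Suc q) = {d \<otimes> T (int q) x [^] (e::int) | d e. d \<in> cyc_span B x q}"

lemma cyc_span_subgroup:
  assumes B: "subgroup B A" and x: "x \<in> carrier A"
  shows "subgroup (cyc_span B x q) A"
proof (induction q)
  case 0 then show ?case using B by simp
next
  case (Suc q)
  let ?D = "cyc_span B x q" and ?y = "T (int q) x"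
  note cl = subgroup.mem_carrier[OF Suc]
  show ?case
  proof (rule subgroupI)
    show "cyc_span B x (Suc q) \<subseteq> carrier A" using cl x by auto
    show "cyc_span B x (Suc q) \<noteq> {}" using subgroup.one_closed[OF Suc] by auto
  next
    fix a assume "a \<in> cyc_span B x (Suc q)"
    then obtain d and e :: int where a: "a = d \<otimes> ?y [^] e" "d \<in> ?D" by auto
    then have "inv a = inv d \<otimes> ?y [^] (- e)" using cl x by (simp add: inv_mult int_pow_neg)
    then show "inv a \<in> cyc_span B x (Suc q)" using subgroup.m_inv_closed[OF Suc a(2)] by auto
  next
    fix a b assume "a \<in> cyc_span B x (Suc q)" "b \<in> cyc_span B x (Suc q)"
    then obtain d d' and e e' :: int where a: "a = d \<otimes> ?y [^] e" "d \<in> ?D"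
      "b = d' \<otimes> ?y [^] e'" "d' \<in> ?D" by auto
    then have "a \<otimes> b = (d \<otimes> d') \<otimes> ?y [^] (e + e')" using cl x by (simp add: int_pow_mult m_ac)
    then show "a \<otimes> b \<in> cyc_span B x (Suc q)" using subgroup.m_closed[OF Suc a(2,4)] by auto
  qed
qed

lemma cyc_span_Suc:
  assumes B: "subgroup B A" and x: "x \<in> carrier A"
  shows "cyc_span B x q \<subseteq> cyc_span B x (Suc q)" "T (int q) x \<in> cyc_span B x (Suc q)"
proof -
  note s = cyc_span_subgroup[OF B x, of q]
  show "cyc_span B x q \<subseteq> cyc_span B x (Suc q)"
  proof
    fix d assume d: "d \<in> cyc_span B x q"
    then have "d = d \<otimes> T (int q) x [^] (0::int)" using subgroup.mem_carrier[OF s] by simp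
    with d show "d \<in> cyc_span B x (Suc q)" unfolding cyc_span.simps by blast
  qed
  have "T (int q) x = \<one> \<otimes> T (int q) x [^] (1::int)" using x by simp
  then show "T (int q) x \<in> cyc_span B x (Suc q)"
    using subgroup.one_closed[OF s] unfolding cyc_span.simps by blast
qed

lemma cyc_span_mono:
  assumes B: "subgroup B A" and x: "x \<in> carrier A"
  shows "q \<le> r \<Longrightarrow> cyc_span B x q \<subseteq> cyc_span B x r"
  using lift_Suc_mono_le[of "cyc_span B x"] cyc_span_Suc(1)[OF B x] by blast

lemma cyc_span_mem:
  assumes B: "subgroup B A" and x: "x \<in> carrier A" and "0 \<le> i" "i < int q"
  shows "T i x \<in> cyc_span B x q"
proof -
  have "Suc (nat i) \<le> q" using assms(3,4) by linarith
  then show ?thesis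
    using cyc_span_Suc(2)[OF B x, of "nat i"] cyc_span_mono[OF B x, of "Suc (nat i)" q] assms(3)
    by (simp del: cyc_span.simps) blast
qed

lemma cyc_span_shift:
  assumes B: "submodule B" and x: "x \<in> carrier A"
  shows "d \<in> cyc_span B x q \<Longrightarrow> T 1 d \<in> cyc_span B x (Suc q)"
proof (induction q arbitrary: d)
  case 0
  then have "T 1 d \<in> cyc_span B x 0" using B by (simp add: submodule_def)
  then show ?case using cyc_span_Suc(1)[OF submodule_subgroup[OF B] x, of 0] by blast
next
  case (Suc q)
  note s = cyc_span_subgroup[OF submodule_subgroup[OF B] x]
  obtain d' and e :: int where d: "d = d' \<otimes> T (int q) x [^] e" "d' \<in> cyc_span B x q"
    using Suc.prems by auto
  then have "T 1 d = T 1 d' \<otimes> T (int (Suc q)) x [^] e"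
    using subgroup.mem_carrier[OF s d(2)] x T_add[OF x, of 1 "int q"]
    by (simp add: T_mult T_int_pow)
  then show ?case using Suc.IH[OF d(2)] unfolding cyc_span.simps(2)[of B x "Suc q"] by blast
qed

lemma cyc_span_finite:
  assumes B: "subgroup B A" and N: "submodule N" "B \<subseteq> N" and n: "0 < (n::nat)"
    and exp: "\<And>y. y \<in> N \<Longrightarrow> y [^] n \<in> B" and x: "x \<in> N"
  shows "finite_mod B (cyc_span B x q)"
proof (induction q)
  case 0
  then show ?case using subgroup.one_closed[OF B] eqv_one[OF B]
    unfolding finite_mod_def by (intro exI[of _ "{\<one>}"]) auto
next
  case (Suc q)
  have xc: "x \<in> carrier A" using N(1) x subgroup.mem_carrier submodule_subgroup by metis
  obtain F where F: "finite F" "F \<subseteq> cyc_span B x q" "\<And>d. d \<in> cyc_span B x q \<Longrightarrow> \<exists>f\<in>F. eqv B d f"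
    using Suc by (auto simp: finite_mod_def)
  let ?y = "T (int q) x"
  have y: "?y \<in> N" "?y \<in> carrier A" using x N(1) xc by (auto simp: submodule_def)
  define F' where "F' = (\<lambda>(f, e::int). f \<otimes> ?y [^] e) ` (F \<times> {0..<int n})"
  have "finite F'" unfolding F'_def using F(1) by auto
  moreover have "F' \<subseteq> cyc_span B x (Suc q)" unfolding F'_def using F(2) by auto
  moreover have "\<exists>f\<in>F'. eqv B a f" if a: "a \<in> cyc_span B x (Suc q)" for a
  proof -
    obtain d and e :: int where a: "a = d \<otimes> ?y [^] e" "d \<in> cyc_span B x q"
      using a by auto
    obtain f where f: "f \<in> F" "eqv B d f" using F(3)[OF a(2)] by auto
    have "?y [^] e = (?y [^] n) [^] (e div int n) \<otimes> ?y [^] (e mod int n)"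
      using int_pow_mult[OF y(2), of "int n * (e div int n)" "e mod int n", symmetric] int_pow_pow[OF y(2), of "int n" "e div int n"]
      by (simp add: int_pow_int)
    moreover have "(?y [^] n) [^] (e div int n) \<in> B"
      using subgroup_int_pow_closed[OF B exp[OF y(1)]] .
    ultimately have "eqv B (?y [^] e) (?y [^] (e mod int n))"
      using eqv_mult[OF B eqv_one[OF B] eqv_refl[OF B], of "(?y [^] n) [^] (e div int n)" "?y [^] (e mod int n)"] y(2)
      by simp
    then have "eqv B a (f \<otimes> ?y [^] (e mod int n))" using a f eqv_mult[OF B] by simp
    moreover have "f \<otimes> ?y [^] (e mod int n) \<in> F'"
      unfolding F'_def using f(1) n by (intro image_eqI[of _ _ "(f, e mod int n)"]) auto
    ultimately show ?thesis by blast
  qed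
  ultimately show ?case unfolding finite_mod_def by blast
qed

lemma eqv_top_mem:
  assumes B: "subgroup B A" and rel: "eqv B (a \<otimes> b) (c \<otimes> d)" and D: "subgroup D A" "B \<subseteq> D"
    and abc: "a \<in> D" "b \<in> D" "c \<in> D" and d: "d \<in> carrier A"
  shows "d \<in> D"
proof -
  have "c \<otimes> d \<in> D"
    using eqv_mem[OF B eqv_sym[OF B rel] D] subgroup.m_closed[OF D(1) abc(1,2)] by simp
  then have "inv c \<otimes> (c \<otimes> d) \<in> D" using subgroup.m_closed[OF D(1)] subgroup.m_inv_closed[OF D(1)] abc(3) by blast
  moreover have "inv c \<otimes> (c \<otimes> d) = d" using subgroup.mem_carrier[OF D(1) abc(3)] d by (simp add: m_assoc[symmetric])
  ultimately show ?thesis by simp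
qed

lemma eqv_cancel:
  assumes B: "subgroup B A" and rel: "eqv B (a \<otimes> b) (c \<otimes> b)" and c: "a \<in> carrier A" "b \<in> carrier A" "c \<in> carrier A"
  shows "eqv B a c"
  using eqv_mult[OF B rel eqv_refl[OF B, of "inv b"]] c by (simp add: m_assoc)

text \<open>If \<open>N/B\<close> has finitely many \<open>t\<close>-orbits, then two of the elements \<open>(1 + t\<^sup>m)x\<close> with \<open>m > 0\<close> lie
  in the same orbit modulo \<open>B\<close>: \<open>(1 + t\<^sup>m\<^sup>')x = t\<^sup>l(1 + t\<^sup>m)x\<close> with \<open>m < m'\<close>. The two polynomials
  differ and have coefficients \<open>0\<close> and \<open>1\<close>, so after multiplying by a power of \<open>t\<close> the relation
  expresses the highest translate of \<open>x\<close> that survives as an integral combination of lower ones.\<close>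
lemma recurrence:
  assumes B: "submodule B" and N: "submodule N" "B \<subseteq> N"
    and W: "finite W" "W \<subseteq> N" and orb: "\<And>y. y \<in> N \<Longrightarrow> \<exists>w\<in>W. \<exists>k. eqv B y (T k w)"
    and x: "x \<in> N"
  shows "\<exists>q>0. T (int q) x \<in> cyc_span B x q"
proof -
  note sB = submodule_subgroup[OF B] and sN = submodule_subgroup[OF N(1)]
  have xc [simp]: "x \<in> carrier A" using subgroup.mem_carrier[OF sN x] .
  define z where "z m = x \<otimes> T (int (Suc m)) x" for m :: nat
  have zN: "z m \<in> N" for m using x N(1) sN by (simp add: z_def subgroup.m_closed submodule_def)
  have zc: "z m \<in> carrier A" for m by (simp add: z_def)
  obtain w k where w: "\<And>m. w m \<in> W" "\<And>m. eqv B (z m) (T (k m) (w m))" using orb[OF zN] by metis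
  have "\<not> inj w" using finite_subset[of "range w" W] w(1) W(1) finite_imageD[of w UNIV] by auto
  then obtain i j where ij: "w i = w j" "i < j" unfolding inj_def by (metis linorder_neqE_nat)
  define l where "l = k j - k i"
  have rel: "eqv B (z j) (T l (z i))"
  proof -
    have "w j \<in> carrier A" using w(1) W(2) subgroup.mem_carrier[OF sN] by blast
    then have "eqv B (T (- k i) (z i)) (w j)" "eqv B (T (- k j) (z j)) (w j)"
      using eqv_T_diff[OF B, of 0 "z i" "k i" "w j"] eqv_T_diff[OF B, of 0 "z j" "k j" "w j"]
        w(2)[of i] w(2)[of j] ij(1) zc T_zero by auto
    then have "eqv B (T (- k i) (z i)) (T (- k j) (z j))" using eqv_trans[OF sB] eqv_sym[OF sB] by blast
    from eqv_T_diff[OF B this zc zc] show ?thesis using eqv_sym[OF sB] by (simp add: l_def)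
  qed
  define m m' where "m = int (Suc i)" and "m' = int (Suc j)"
  have mm: "0 < m" "m < m'" using ij by (auto simp: m_def m'_def)
  have rel1: "eqv B (x \<otimes> T m' x) (T l x \<otimes> T (l + m) x)"
    using rel T_add[of x l m] by (simp add: z_def m_def m'_def T_mult)
  have top: "0 < p \<Longrightarrow> T p x \<in> cyc_span B x (nat p) \<Longrightarrow> ?thesis" for p
    by (intro exI[of _ "nat p"]) simp
  have span: "subgroup (cyc_span B x q) A" "B \<subseteq> cyc_span B x q"
    "\<And>i. 0 \<le> i \<Longrightarrow> i < int q \<Longrightarrow> T i x \<in> cyc_span B x q" for q
    using cyc_span_subgroup[OF sB xc] cyc_span_mono[OF sB xc, of 0 q] cyc_span_mem[OF sB xc] by auto
  \<comment> \<open>The highest exponent is \<open>l + m\<close>, or \<open>m'\<close>; if the two agree, these terms cancel and \<open>l\<close> is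
    left; for \<open>l < 0\<close> it is \<open>m' - l\<close>, after multiplying by \<open>t\<^sup>-\<^sup>l\<close>.\<close>
  consider "0 \<le> l" "m' < l + m" | "0 \<le> l" "l + m < m'" | "0 \<le> l" "l + m = m'" | "l < 0" by linarith
  then show ?thesis
  proof cases
    case 1
    have "T (l + m) x \<in> cyc_span B x (nat (l + m))"
      by (rule eqv_top_mem[OF sB rel1 span(1,2)]) (use 1 mm span(3)[of 0] in \<open>simp_all add: span(3) T_zero\<close>)
    then show ?thesis using top[of "l + m"] 1 mm by simp
  next
    case 2
    have r: "eqv B (T l x \<otimes> T (l + m) x) (x \<otimes> T m' x)" using eqv_sym[OF sB rel1] .
    have "T m' x \<in> cyc_span B x (nat m')"
      by (rule eqv_top_mem[OF sB r span(1,2)]) (use 2 mm span(3)[of 0] in \<open>simp_all add: span(3) T_zero\<close>)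
    then show ?thesis using top[of m'] mm by simp
  next
    case 3
    then have r: "eqv B x (T l x)" using eqv_cancel[OF sB, of x "T m' x" "T l x"] rel1 by simp
    have "x \<in> cyc_span B x (nat l)" using span(3)[of 0 "nat l"] 3 mm by (simp add: T_zero)
    then have "T l x \<in> cyc_span B x (nat l)"
      using eqv_mem[OF sB eqv_sym[OF sB r] span(1,2)] by simp
    then show ?thesis using top[of l] 3 mm by simp
  next
    case 4
    have "eqv B (T (- l) (T l x \<otimes> T (l + m) x)) (T (- l) (x \<otimes> T m' x))"
      using eqv_T[OF B eqv_sym[OF sB rel1]] .
    then have r: "eqv B (x \<otimes> T m x) (T (- l) x \<otimes> T (m' - l) x)"
      using T_add[OF xc, of "-l" "l + m"] T_add[OF xc, of "-l" m'] by (simp add: T_mult)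
    have "T (m' - l) x \<in> cyc_span B x (nat (m' - l))"
      by (rule eqv_top_mem[OF sB r span(1,2)]) (use 4 mm span(3)[of 0] in \<open>simp_all add: span(3) T_zero\<close>)
    then show ?thesis using top[of "m' - l"] 4 mm by simp
  qed
qed

text \<open>By the recurrence each \<open>x\<close> lies in a \<open>t\<close>-invariant subgroup that is finite over \<open>B\<close>. So its
  orbit modulo \<open>B\<close> is finite, and \<open>N/B\<close> is a finite union of finite orbits.\<close>
lemma finite_orbits_imp_finite_mod:
  assumes B: "submodule B" and N: "submodule N" "B \<subseteq> N" and n: "0 < (n::nat)"
    and exp: "\<And>y. y \<in> N \<Longrightarrow> y [^] n \<in> B"
    and W: "finite W" "W \<subseteq> N" and orb: "\<And>y. y \<in> N \<Longrightarrow> \<exists>w\<in>W. \<exists>k. eqv B y (T k w)"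
  shows "finite_mod B N"
proof -
  note sB = submodule_subgroup[OF B] and sN = submodule_subgroup[OF N(1)]
  have "\<exists>p>0. eqv B (T p x) x" if x: "x \<in> N" for x
  proof -
    have xc: "x \<in> carrier A" using subgroup.mem_carrier[OF sN x] .
    obtain q where q: "0 < q" "T (int q) x \<in> cyc_span B x q"
      using recurrence[OF B N W orb x] by blast
    note sub = cyc_span_subgroup[OF sB xc]
    have "cyc_span B x (Suc q) \<subseteq> cyc_span B x q"
      using subgroup.m_closed[OF sub] subgroup_int_pow_closed[OF sub q(2)] by auto
    then have shift: "T 1 d \<in> cyc_span B x q" if "d \<in> cyc_span B x q" for d
      using cyc_span_shift[OF B xc that] by blast
    have "T (int i) x \<in> cyc_span B x q" for i
    proof (induction i)
      case 0 then show ?case using cyc_span_mem[OF sB xc, of 0 q] q(1) by simp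
    next
      case (Suc i) then show ?case using shift T_add[OF xc, of 1 "int i"] by (metis of_nat_Suc)
    qed
    then obtain i j where ij: "i < j" "eqv B (T (int j) x) (T (int i) x)"
      using finite_mod_pigeonhole[OF sB cyc_span_finite[OF sB N n exp x], of "\<lambda>i. T (int i) x" q] by blast
    show ?thesis using eqv_T_diff[OF B ij(2) xc xc] ij(1) by (intro exI[of _ "int j - int i"]) simp
  qed
  then obtain p where p: "\<And>x. x \<in> N \<Longrightarrow> 0 < p x \<and> eqv B (T (p x) x) x" by metis
  define F where "F = (\<Union>w\<in>W. (\<lambda>i. T i w) ` {0..<p w})"
  have "finite F" unfolding F_def using W(1) by simp
  moreover have "F \<subseteq> N" unfolding F_def using W(2) N(1) by (auto simp: submodule_def)
  moreover have "\<exists>f\<in>F. eqv B y f" if y: "y \<in> N" for y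
  proof -
    obtain w k where w: "w \<in> W" "eqv B y (T k w)" using orb[OF y] by blast
    have wN: "w \<in> N" and wc: "w \<in> carrier A" using w(1) W(2) subgroup.mem_carrier[OF sN] by auto
    have "T k w = T (k mod p w) (T (p w * (k div p w)) w)" using T_add[OF wc, symmetric] by simp
    then have "eqv B (T k w) (T (k mod p w) w)"
      using eqv_T[OF B eqv_T_iterate[OF B _ wc]] p[OF wN] by metis
    moreover have "T (k mod p w) w \<in> F" unfolding F_def using p[OF wN] by (intro UN_I[OF w(1)]) auto
    ultimately show ?thesis using eqv_trans[OF sB w(2)] by blast
  qed
  ultimately show ?thesis unfolding finite_mod_def by blast
qed

lemma submodule_powers:
  assumes N: "submodule N"
  shows "submodule ((\<lambda>y. y [^] (n::nat)) ` N)"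
proof -
  note sN = submodule_subgroup[OF N]
  note cl = subgroup.mem_carrier[OF sN]
  have "subgroup ((\<lambda>y. y [^] n) ` N) A"
  proof (rule subgroupI)
    show "(\<lambda>y. y [^] n) ` N \<subseteq> carrier A" using cl by auto
    show "(\<lambda>y. y [^] n) ` N \<noteq> {}" using subgroup.one_closed[OF sN] by auto
  next
    fix a assume "a \<in> (\<lambda>y. y [^] n) ` N"
    then obtain y where y: "a = y [^] n" "y \<in> N" by auto
    then have "inv a = (inv y) [^] n" using cl by (simp add: nat_pow_inv)
    then show "inv a \<in> (\<lambda>y. y [^] n) ` N" using subgroup.m_inv_closed[OF sN y(2)] by auto
  next
    fix a b assume "a \<in> (\<lambda>y. y [^] n) ` N" "b \<in> (\<lambda>y. y [^] n) ` N"
    then obtain y z where y: "a = y [^] n" "y \<in> N" "b = z [^] n" "z \<in> N" by auto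
    then have "a \<otimes> b = (y \<otimes> z) [^] n" using cl by (simp add: nat_pow_distrib)
    then show "a \<otimes> b \<in> (\<lambda>y. y [^] n) ` N" using subgroup.m_closed[OF sN y(2,4)] by auto
  qed
  moreover have "T k a \<in> (\<lambda>y. y [^] n) ` N" if "a \<in> (\<lambda>y. y [^] n) ` N" for k a
    using that N cl by (auto simp: submodule_def T_nat_pow)
  ultimately show ?thesis by (simp add: submodule_def)
qed

lemma finite_mod_trans:
  assumes B: "subgroup B A" and N: "subgroup N A" "B \<subseteq> N"
    and fin: "finite_mod B N" "finite_mod N (carrier A)"
  shows "finite_mod B (carrier A)"
proof -
  obtain F where F: "finite F" "F \<subseteq> N" "\<And>x. x \<in> N \<Longrightarrow> \<exists>f\<in>F. eqv B x f"
    using fin(1) by (auto simp: finite_mod_def)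
  obtain F' where F': "finite F'" "F' \<subseteq> carrier A" "\<And>x. x \<in> carrier A \<Longrightarrow> \<exists>f\<in>F'. eqv N x f"
    using fin(2) by (auto simp: finite_mod_def)
  have "\<exists>f\<in>(\<lambda>(f, f'). f \<otimes> f') ` (F \<times> F'). eqv B x f" if x: "x \<in> carrier A" for x
  proof -
    obtain f' where f': "f' \<in> F'" "eqv N x f'" using F'(3)[OF x] by auto
    obtain f where f: "f \<in> F" "eqv B (x \<otimes> inv f') f" using F(3) f'(2) by (auto simp: eqv_def)
    have "eqv B (x \<otimes> inv f' \<otimes> f') (f \<otimes> f')"
      using eqv_mult[OF B f(2) eqv_refl[OF B]] f' F'(2) by auto
    then have "eqv B x (f \<otimes> f')" using x f' F'(2) by (auto simp: m_assoc)
    then show ?thesis using f(1) f'(1) by force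
  qed
  moreover have "(\<lambda>(f, f'). f \<otimes> f') ` (F \<times> F') \<subseteq> carrier A"
    using F(2) F'(2) subgroup.mem_carrier[OF N(1)] by auto
  moreover have "finite ((\<lambda>(f, f'). f \<otimes> f') ` (F \<times> F'))" using F(1) F'(1) by simp
  ultimately show ?thesis unfolding finite_mod_def by blast
qed

lemma finite_mod_pow_mem:
  assumes N: "subgroup N A" and fin: "finite_mod N (carrier A)" and c: "c \<in> carrier A"
  shows "\<exists>s::nat>0. c [^] s \<in> N"
proof -
  obtain i j :: nat where ij: "i < j" "eqv N (c [^] j) (c [^] i)"
    using finite_mod_pigeonhole[OF N fin, of "\<lambda>i. c [^] i"] c by auto
  have "c [^] j = c [^] (j - i) \<otimes> c [^] i" using c ij(1) by (simp add: nat_pow_mult)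
  then have "c [^] j \<otimes> inv (c [^] i) = c [^] (j - i)" using c by (simp add: m_assoc)
  then have "c [^] (j - i) \<in> N" using ij(2) by (simp add: eqv_def)
  then show ?thesis using ij(1) by (intro exI[of _ "j - i"]) simp
qed

text \<open>The cosets \<open>\<langle>c\<rangle>f\<close> become finite modulo \<open>nN\<close>, because some positive power of \<open>c\<close> lies in
  \<open>nN\<close>. So \<open>N/nN\<close> has finitely many \<open>t\<close>-orbits and is finite, and minimality gives \<open>nN = N\<close>.\<close>
lemma minimal_submodule_divisible:
  assumes P: "finite P" "P \<subseteq> carrier A \<times> carrier A"
    and cover: "\<And>x. x \<in> carrier A \<Longrightarrow> \<exists>(c, f)\<in>P. \<exists>k. \<exists>z::int. x = T k (c [^] z \<otimes> f)"
    and N: "submodule N" and fin: "finite_mod N (carrier A)"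
    and minimal: "\<And>B. submodule B \<Longrightarrow> finite_mod B (carrier A) \<Longrightarrow> B \<subseteq> N \<Longrightarrow> B = N"
    and n: "0 < (n::nat)" and x: "x \<in> N"
  shows "\<exists>y\<in>N. x = y [^] n"
proof -
  let ?B = "(\<lambda>y. y [^] n) ` N"
  note sN = submodule_subgroup[OF N]
  have B: "submodule ?B" using submodule_powers[OF N] .
  note sB = submodule_subgroup[OF B]
  have BN: "?B \<subseteq> N" using subgroup_int_pow_closed[OF sN, of _ "int n"] by (auto simp: int_pow_int)
  have exp: "y [^] n \<in> ?B" if "y \<in> N" for y using that by auto
  have "\<exists>s::nat>0. c [^] s \<in> ?B" if c: "c \<in> carrier A" for c
  proof -
    obtain s :: nat where "0 < s" "c [^] s \<in> N" using finite_mod_pow_mem[OF sN fin c] by blast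
    then show ?thesis using exp[of "c [^] s"] n c by (intro exI[of _ "s * n"]) (simp add: nat_pow_pow)
  qed
  then obtain s :: "'a \<Rightarrow> nat" where s: "\<And>c. c \<in> carrier A \<Longrightarrow> 0 < s c \<and> c [^] s c \<in> ?B" by metis
  define W where "W = (\<Union>(c, f)\<in>P. (\<lambda>z::int. c [^] z \<otimes> f) ` {0..<int (s c)}) \<inter> N"
  have W: "finite W" "W \<subseteq> N" unfolding W_def using P(1) by (auto intro!: finite_Int)
  have "\<exists>w\<in>W. \<exists>k. eqv ?B y (T k w)" if y: "y \<in> N" for y
  proof -
    have yc: "y \<in> carrier A" using subgroup.mem_carrier[OF sN y] .
    obtain c f k and z :: int where c: "(c, f) \<in> P" "y = T k (c [^] z \<otimes> f)" using cover[OF yc] by blast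
    have cf: "c \<in> carrier A" "f \<in> carrier A" using c(1) P(2) by auto
    let ?u = "c [^] z \<otimes> f" and ?w = "c [^] (z mod int (s c)) \<otimes> f"
    have uN: "?u \<in> N" using T_mem_iff[OF N, of ?u k] cf y c(2) by simp
    have "c [^] z = (c [^] s c) [^] (z div int (s c)) \<otimes> c [^] (z mod int (s c))"
      using int_pow_mult[OF cf(1), of "int (s c) * (z div int (s c))" "z mod int (s c)", symmetric]
        int_pow_pow[OF cf(1), of "int (s c)" "z div int (s c)"]
      by (simp add: int_pow_int)
    moreover have "(c [^] s c) [^] (z div int (s c)) \<in> ?B"
      using subgroup_int_pow_closed[OF sB] s[OF cf(1)] by blast
    ultimately have "eqv ?B (c [^] z) (c [^] (z mod int (s c)))"
      using eqv_mult[OF sB eqv_one[OF sB] eqv_refl[OF sB], of "(c [^] s c) [^] (z div int (s c))"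
          "c [^] (z mod int (s c))"] cf by simp
    then have uw: "eqv ?B ?u ?w" using eqv_mult[OF sB _ eqv_refl[OF sB cf(2)]] by blast
    have "?w \<in> N" using eqv_mem[OF sB eqv_sym[OF sB uw] sN BN uN] .
    moreover have "?w \<in> (\<Union>(c, f)\<in>P. (\<lambda>z::int. c [^] z \<otimes> f) ` {0..<int (s c)})"
      using c(1) s[OF cf(1)] by (intro UN_I[OF c(1)]) auto
    ultimately have "?w \<in> W" unfolding W_def by blast
    moreover have "eqv ?B y (T k ?w)" using eqv_T[OF B uw] c(2) by simp
    ultimately show ?thesis by blast
  qed
  from finite_orbits_imp_finite_mod[OF B N BN n exp W this]
  have "finite_mod ?B (carrier A)" using finite_mod_trans[OF sB sN BN _ fin] by blast
  then have "?B = N" using minimal[OF B _ BN] by blast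
  then show ?thesis using x by blast
qed

definition torsion :: "'a \<Rightarrow> bool" where
  "torsion x \<longleftrightarrow> (\<exists>n::int. n \<noteq> 0 \<and> x [^] n = \<one>)"

lemma torsion_nat:
  assumes "torsion x" "x \<in> carrier A"
  shows "\<exists>n::nat>0. x [^] n = \<one>"
proof -
  obtain n :: int where n: "n \<noteq> 0" "x [^] n = \<one>" using assms(1) by (auto simp: torsion_def)
  have "x [^] \<bar>n\<bar> = \<one>" using n(2) int_pow_neg[OF assms(2), of n] by (cases "0 \<le> n") auto
  then show ?thesis using n(1) by (intro exI[of _ "nat \<bar>n\<bar>"]) (auto simp: int_pow_int[symmetric])
qed

lemma T_eq_one_iff: "x \<in> carrier A \<Longrightarrow> T k x = \<one> \<longleftrightarrow> x = \<one>"
  by (metis T_cancel(1) T_one)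

lemma torsion_T: "x \<in> carrier A \<Longrightarrow> torsion (T k x) \<longleftrightarrow> torsion x"
  by (simp add: torsion_def T_int_pow[symmetric] T_eq_one_iff)

lemma torsion_pow: "x \<in> carrier A \<Longrightarrow> (n::int) \<noteq> 0 \<Longrightarrow> torsion (x [^] n) \<longleftrightarrow> torsion x"
  unfolding torsion_def
  by (metis int_pow_pow int_pow_one mult.commute mult_eq_0_iff)

lemma pow_eq_pow_iff:
  "x \<in> carrier A \<Longrightarrow> \<not> torsion x \<Longrightarrow> x [^] (i::int) = x [^] j \<longleftrightarrow> i = j"
  unfolding torsion_def by (metis int_pow_diff eq_iff_diff_eq_0 r_inv int_pow_closed)

text \<open>An element whose \<open>E\<close>-th power is a translate of a power of \<open>c\<close> is torsion only if that power
  is trivial or \<open>c\<close> is torsion, and only finitely many \<open>c\<close> occur. So the torsion of \<open>N\<close> has a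
  bounded exponent \<open>m\<close>; a torsion element \<open>y\<^sup>m\<close> then has a torsion root \<open>y\<close> and is trivial.\<close>
lemma divisible_imp_torsion_free:
  assumes P: "finite P" "P \<subseteq> carrier A \<times> carrier A" and E: "0 < (E::nat)"
    and cover: "\<And>x. x \<in> carrier A \<Longrightarrow> \<exists>(c, f)\<in>P. \<exists>k. \<exists>y::int. x [^] E = T k (c [^] y)"
    and N: "N \<subseteq> carrier A"
    and div: "\<And>n::nat. \<And>x. 0 < n \<Longrightarrow> x \<in> N \<Longrightarrow> \<exists>y\<in>N. x = y [^] n"
    and x: "x \<in> N" "torsion x"
  shows "x = \<one>"
proof -
  obtain r where r: "\<And>c. c \<in> carrier A \<Longrightarrow> torsion c \<Longrightarrow> 0 < (r c :: nat) \<and> c [^] r c = \<one>"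
    using torsion_nat by metis
  define Q where "Q = {c \<in> fst ` P. torsion c}"
  have Q: "finite Q" "\<And>c. c \<in> Q \<Longrightarrow> c \<in> carrier A \<and> torsion c" unfolding Q_def using P by auto
  define m where "m = E * (\<Prod>c\<in>Q. r c)"
  have m: "0 < m" unfolding m_def using E Q r by (auto intro!: prod_pos)
  obtain y where y: "y \<in> N" "x = y [^] m" using div[OF m x(1)] by blast
  have yc: "y \<in> carrier A" using y(1) N by auto
  have yt: "torsion y" using torsion_pow[OF yc, of "int m"] m x(2) y(2) by (simp add: int_pow_int)
  obtain c f k and z :: int where c: "(c, f) \<in> P" "y [^] E = T k (c [^] z)" using cover[OF yc] by blast
  have cc: "c \<in> carrier A" using c(1) P(2) by auto
  have tor: "torsion (c [^] z)"
    using torsion_T[of "c [^] z" k] torsion_pow[OF yc, of "int E"] yt E c(2) cc by (simp add: int_pow_int)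
  have "(c [^] z) [^] (\<Prod>c\<in>Q. r c) = \<one>"
  proof (cases "z = 0")
    case False
    then have "torsion c" using tor torsion_pow[OF cc] by blast
    then have "c \<in> Q" unfolding Q_def using c(1) by force
    then have "r c dvd (\<Prod>c\<in>Q. r c)" using Q(1) by (simp add: dvd_prod_eqI)
    then obtain j where "(\<Prod>c\<in>Q. r c) = r c * j" by auto
    then have "c [^] (\<Prod>c\<in>Q. r c) = \<one>" using r[OF cc \<open>torsion c\<close>] cc by (simp add: nat_pow_pow[symmetric])
    then have "(c [^] int (\<Prod>c\<in>Q. r c)) [^] z = \<one>" by (simp only: int_pow_int) simp
    then show ?thesis using cc by (simp only: int_pow_int[symmetric] int_pow_pow mult.commute)
  qed simp
  then have "(y [^] E) [^] (\<Prod>c\<in>Q. r c) = \<one>" using c(2) cc by (simp add: T_nat_pow[symmetric])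
  then show ?thesis using y(2) yc by (simp add: m_def nat_pow_pow)
qed

lemma T_iterate_pow:
  assumes c: "c \<in> carrier A" and rel: "T s (c [^] (b::int)) = c [^] (a::int)"
  shows "T (s * int j) (c [^] (b ^ j)) = c [^] (a ^ j)"
proof (induction j)
  case 0 then show ?case using c T_zero by simp
next
  case (Suc j)
  have "T (s * int (Suc j)) (c [^] (b ^ Suc j)) = T (s * int j) (T s ((c [^] b) [^] (b ^ j)))"
    using T_add[of "c [^] (b ^ Suc j)" "s * int j" s] c by (simp add: int_pow_pow algebra_simps)
  also have "\<dots> = T (s * int j) ((c [^] (b ^ j)) [^] a)"
    using c by (simp add: T_int_pow rel) (simp add: T_int_pow[symmetric] int_pow_pow mult.commute)
  also have "\<dots> = (c [^] (a ^ j)) [^] a" using c Suc by (simp add: T_int_pow)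
  finally show ?case using c by (simp add: int_pow_pow mult.commute)
qed

text \<open>Suppose \<open>x \<noteq> \<one>\<close>, and put \<open>v = x\<^sup>E\<close>. Extracting a \<open>p\<close>-th root of \<open>x\<close> for every prime \<open>p\<close> shows
  that \<open>v\<close> is a translate of a \<open>p\<close>-th power in \<open>\<langle>c\<rangle>\<close>, with the same \<open>c\<close> for infinitely many \<open>p\<close>.
  So \<open>c\<^sup>w\<close> is a translate of \<open>c\<^sup>z\<^sup>p\<close> for a fixed \<open>w \<noteq> 0\<close>. The exponents \<open>k\<close> for which \<open>t\<^sup>k\<close> preserves
  the line spanned by \<open>c\<close> form a group \<open>D = s\<int>\<close>, and \<open>t\<^sup>s\<close> acts on that line as a fraction \<open>a/b\<close>.
  Therefore \<open>w = zp(a/b)\<^sup>j\<close> for some integer \<open>j\<close>, and \<open>p\<close> divides \<open>wab\<close>; this is possible for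
  finitely many \<open>p\<close> only.\<close>
lemma divisible_imp_trivial:
  assumes P: "finite P" "P \<subseteq> carrier A \<times> carrier A" and E: "0 < (E::nat)"
    and cover: "\<And>x. x \<in> carrier A \<Longrightarrow> \<exists>(c, f)\<in>P. \<exists>k. \<exists>y::int. x [^] E = T k (c [^] y)"
    and N: "N \<subseteq> carrier A"
    and div: "\<And>n::nat. \<And>x. 0 < n \<Longrightarrow> x \<in> N \<Longrightarrow> \<exists>y\<in>N. x = y [^] n"
    and x: "x \<in> N"
  shows "x = \<one>"
proof (rule ccontr)
  assume "x \<noteq> \<one>"
  then have tf: "\<not> torsion x" using divisible_imp_torsion_free[OF P E cover N div x] by blast
  have xc: "x \<in> carrier A" using x N by auto
  define v where "v = x [^] E"
  have v: "v \<in> carrier A" "\<not> torsion v"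
    using tf torsion_pow[OF xc, of "int E"] xc E by (auto simp: v_def int_pow_int)
  have "\<exists>c\<in>fst ` P. \<exists>k. \<exists>z::int. v = T k (c [^] (z * int p))" if p: "Factorial_Ring.prime (p::nat)" for p
  proof -
    obtain y where y: "y \<in> N" "x = y [^] p" using div[OF prime_gt_0_nat[OF p] x] by blast
    have yc: "y \<in> carrier A" using y(1) N by auto
    obtain c f k and z :: int where c: "(c, f) \<in> P" "y [^] E = T k (c [^] z)" using cover[OF yc] by blast
    have cc: "c \<in> carrier A" using c(1) P(2) by auto
    have "v = (y [^] E) [^] p" using y(2) yc by (simp add: v_def nat_pow_pow mult.commute)
    also have "\<dots> = T k ((c [^] z) [^] int p)" using c(2) cc by (simp add: T_nat_pow int_pow_int)
    finally show ?thesis using c(1) cc by (force simp: int_pow_pow)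
  qed
  then obtain h where h: "\<And>p::nat. Factorial_Ring.prime p \<Longrightarrow> h p \<in> fst ` P \<and> (\<exists>k. \<exists>z::int. v = T k (h p [^] (z * int p)))"
    by metis
  have "h ` {p. Factorial_Ring.prime p} \<subseteq> fst ` P" using h by auto
  then have "finite (h ` {p::nat. Factorial_Ring.prime p})" using P(1) finite_subset by blast
  then obtain p0 where p0: "Factorial_Ring.prime (p0::nat)" "infinite {p \<in> {p. Factorial_Ring.prime p}. h p = h p0}"
    using pigeonhole_infinite[of "{p::nat. Factorial_Ring.prime p}" h] primes_infinite by auto
  define c where "c = h p0"
  define S where "S = {p::nat. Factorial_Ring.prime p \<and> h p = c}"
  have S: "infinite S" "p0 \<in> S" using p0 by (auto simp: S_def c_def)
  have c: "c \<in> carrier A" using h[OF p0(1)] P(2) by (auto simp: c_def)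
  have pS: "Factorial_Ring.prime p" "\<exists>k. \<exists>z::int. v = T k (c [^] (z * int p))" if "p \<in> S" for p
    using that h[of p] by (auto simp: S_def)
  obtain k0 w where kw: "v = T k0 (c [^] (w::int))" using pS(2)[OF S(2)] by blast
  have cw: "\<not> torsion (c [^] w)" using v(2) torsion_T[of "c [^] w" k0] kw c by simp
  have "torsion \<one>" unfolding torsion_def by (intro exI[of _ 1]) simp
  then have w: "w \<noteq> 0" using cw by (cases "w = 0") simp_all
  have ct: "\<not> torsion c" using cw torsion_pow[OF c w] by blast
  define D where "D = {k. \<exists>(a::int) (b::int). a \<noteq> 0 \<and> b \<noteq> 0 \<and> T k (c [^] b) = c [^] a}"
  have D_I: "k \<in> D" if "a \<noteq> 0" "b \<noteq> 0" "T k (c [^] b) = c [^] a" for k and a b :: int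
    unfolding D_def by (rule CollectI, rule exI[of _ a], rule exI[of _ b]) (simp add: that)
  have "0 \<in> D" using D_I[of 1 1 0] T_zero c by simp
  moreover have "k - l \<in> D" if kl: "k \<in> D" "l \<in> D" for k l
  proof -
    obtain a b a' b' :: int where ab: "a \<noteq> 0" "b \<noteq> 0" "T k (c [^] b) = c [^] a"
      "a' \<noteq> 0" "b' \<noteq> 0" "T l (c [^] b') = c [^] a'" using kl unfolding D_def by blast
    have "T (k - l) (c [^] (a' * b)) = T k (T (- l) (c [^] (a' * b)))"
      using T_add[of "c [^] (a' * b)" k "- l"] c by simp
    also have "T (- l) (c [^] (a' * b)) = T (- l) (T l (c [^] b') [^] b)"
      using c ab(6) by (simp add: int_pow_pow)
    also have "\<dots> = (c [^] b) [^] b'"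
      using c T_int_pow[of "c [^] b'" l b, symmetric] by (simp add: int_pow_pow mult.commute)
    also have "T k \<dots> = c [^] (a * b')" using c ab(3) T_int_pow[of "c [^] b" k b'] by (simp add: int_pow_pow)
    finally show ?thesis using D_I[of "a * b'" "a' * b"] ab by simp
  qed
  ultimately obtain s where s: "s \<in> D" "\<And>k. k \<in> D \<Longrightarrow> s dvd k"
    using int_subgroup_principal[of D] by blast
  obtain a b :: int where ab: "a \<noteq> 0" "b \<noteq> 0" "T s (c [^] b) = c [^] a" using s(1) unfolding D_def by blast
  have ba: "T (- s) (c [^] a) = c [^] b" using ab(3) c by (metis T_cancel(1) int_pow_closed)
  have "int p dvd w * a * b" if p: "p \<in> S" for p
  proof -
    have prime: "Factorial_Ring.prime (int p)" using pS(1)[OF p] by simp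
    obtain k z where kz: "v = T k (c [^] (z * int p))" using pS(2)[OF p] by blast
    have "T (k - k0) (c [^] (z * int p)) = T (- k0) v"
      using T_add[of "c [^] (z * int p)" "- k0" k] kz c by simp
    then have e: "T (k - k0) (c [^] (z * int p)) = c [^] w" using kw c by simp
    then have "z * int p \<noteq> 0" using pow_eq_pow_iff[OF c ct, of 0 w] w by auto
    then have "k - k0 \<in> D" using D_I[OF w _ e] by blast
    then obtain j where j: "k - k0 = s * j" using s(2) by blast
    have key: "w * b' ^ i = a' ^ i * (z * int p)"
      if "T (s' * int i) (c [^] (b' ^ i)) = c [^] (a' ^ i)" "k - k0 = s' * int i" for s' a' b' :: int and i
    proof -
      have "c [^] (w * b' ^ i) = T (k - k0) (c [^] (z * int p)) [^] (b' ^ i)" using e c by (simp add: int_pow_pow)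
      also have "\<dots> = T (s' * int i) (c [^] (b' ^ i)) [^] (z * int p)"
        using c that(2) T_int_pow[of "c [^] (z * int p)" "k - k0" "b' ^ i", symmetric]
          T_int_pow[of "c [^] (b' ^ i)" "k - k0" "z * int p", symmetric]
        by (simp add: int_pow_pow mult.commute)
      also have "\<dots> = c [^] (a' ^ i * (z * int p))" using that(1) c by (simp add: int_pow_pow)
      finally show ?thesis using pow_eq_pow_iff[OF c ct] by simp
    qed
    have "\<exists>i. int p dvd w * b ^ i \<or> int p dvd w * a ^ i"
    proof (cases "0 \<le> j")
      case True
      then have "w * b ^ nat j = a ^ nat j * (z * int p)"
        using key[OF T_iterate_pow[OF c ab(3)], of "nat j"] j by simp
      then show ?thesis by (metis dvd_mult dvd_triv_right)
    next
      case False
      then have "w * a ^ nat (- j) = b ^ nat (- j) * (z * int p)"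
        using key[OF T_iterate_pow[OF c ba], of "nat (- j)"] j by simp
      then show ?thesis by (metis dvd_mult dvd_triv_right)
    qed
    then have "int p dvd w \<or> int p dvd b \<or> int p dvd a"
      using prime_dvd_power[OF prime] prime_dvd_mult_iff[OF prime] by blast
    then show ?thesis by auto
  qed
  then have "S \<subseteq> {p. p dvd nat \<bar>w * a * b\<bar>}" by auto
  moreover have "finite {p. p dvd nat \<bar>w * a * b\<bar>}" using w ab by (intro finite_divisors_nat) simp
  ultimately show False using S(1) finite_subset by blast
qed

text \<open>The cover describes \<open>A\<close> as the union of all translates of finitely many cosets \<open>\<langle>c\<rangle>f\<close> coming
  from virtually cyclic groups; the exponent \<open>E\<close> records that such a group has a power inside
  \<open>\<langle>c\<rangle>\<close>.\<close>
theorem finite_carrier: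
  fixes I :: "'i set"
  assumes P: "finite P" "P \<subseteq> carrier A \<times> carrier A" and E: "0 < (E::nat)"
    and cover: "\<And>x. x \<in> carrier A \<Longrightarrow>
      \<exists>(c, f)\<in>P. \<exists>k. \<exists>(z::int) (y::int). x = T k (c [^] z \<otimes> f) \<and> x [^] E = T k (c [^] y)"
    and I: "finite I"
    and layer: "\<And>k::int. 0 < k \<Longrightarrow> \<exists>\<sigma>. \<forall>a\<in>carrier A. \<exists>i\<in>I. \<sigma> i \<in> carrier A \<and>
      (\<exists>j. \<exists>b\<in>carrier A. a = T j (\<sigma> i \<otimes> (b \<otimes> inv (T k b))))"
  shows "finite (carrier A)"
proof -
  have cover1: "\<exists>(c, f)\<in>P. \<exists>k. \<exists>z::int. x = T k (c [^] z \<otimes> f)" if "x \<in> carrier A" for x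
    using cover[OF that] by blast
  have cover2: "\<exists>(c, f)\<in>P. \<exists>k. \<exists>y::int. x [^] E = T k (c [^] y)" if "x \<in> carrier A" for x
    using cover[OF that] by blast
  obtain N where N: "submodule N" "finite_mod N (carrier A)"
    "\<And>B. submodule B \<Longrightarrow> finite_mod B (carrier A) \<Longrightarrow> B \<subseteq> N \<Longrightarrow> B = N"
    using minimal_cofinite_submodule[OF I layer] by blast
  have NA: "N \<subseteq> carrier A" using subgroup.subset[OF submodule_subgroup[OF N(1)]] .
  have "x = \<one>" if "x \<in> N" for x
    by (rule divisible_imp_trivial[OF P E cover2 NA minimal_submodule_divisible[OF P cover1 N] that])
  moreover obtain F where F: "finite F" "F \<subseteq> carrier A" "\<And>x. x \<in> carrier A \<Longrightarrow> \<exists>f\<in>F. eqv N x f"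
    using N(2) by (auto simp: finite_mod_def)
  ultimately have "x \<in> F" if x: "x \<in> carrier A" for x
  proof -
    obtain f where f: "f \<in> F" "x \<otimes> inv f = \<one>" using F(3)[OF x] \<open>\<And>x. x \<in> N \<Longrightarrow> x = \<one>\<close> by (auto simp: eqv_def)
    then have "x = f" using x F(2) inv_equality[of x "inv f"] by auto
    then show ?thesis using f by simp
  qed
  then show ?thesis by (intro finite_subset[OF _ F(1)] subsetI)
qed

end

section \<open>Groups covered by conjugates of virtually cyclic groups\<close>

definition conjugated :: "('a, 'b) monoid_scheme \<Rightarrow> 'a \<Rightarrow> 'a \<Rightarrow> 'a" where
  "conjugated G g x = g \<otimes>\<^bsub>G\<^esub> x \<otimes>\<^bsub>G\<^esub> inv\<^bsub>G\<^esub> g"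

text \<open>For normal \<open>N\<close> this says that \<open>G/N\<close> is virtually cyclic. It is phrased in \<open>G\<close> itself so that
  an induction along a normal series need not change the type of the group.\<close>
definition vc_mod :: "('a, 'b) monoid_scheme \<Rightarrow> 'a set \<Rightarrow> bool" where
  "vc_mod G N \<longleftrightarrow> (\<exists>t\<in>carrier G. \<exists>F. finite F \<and> F \<subseteq> carrier G \<and>
     (\<forall>x\<in>carrier G. \<exists>n\<in>N. \<exists>k::int. \<exists>f\<in>F. x = n \<otimes>\<^bsub>G\<^esub> t [^]\<^bsub>G\<^esub> k \<otimes>\<^bsub>G\<^esub> f))"

text \<open>A virtually cyclic group is a finite union of cosets \<open>\<langle>c\<rangle>f\<close>, and some fixed power of all its
  elements lies in \<open>\<langle>c\<rangle>\<close>. This keeps exactly that information about a finite family of such groups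
  whose conjugates by elements of \<open>S\<close> cover \<open>G\<close>; in this form it is inherited by quotients.\<close>
definition vc_cover :: "('a, 'b) monoid_scheme \<Rightarrow> 'a set \<Rightarrow> ('a \<times> 'a) set \<Rightarrow> nat \<Rightarrow> bool" where
  "vc_cover G S P E \<longleftrightarrow> finite P \<and> P \<subseteq> carrier G \<times> carrier G \<and> 0 < E \<and>
     (\<forall>x\<in>carrier G. \<exists>(c, f)\<in>P. \<exists>g\<in>S. \<exists>(z::int) (y::int).
        x = conjugated G g (c [^]\<^bsub>G\<^esub> z \<otimes>\<^bsub>G\<^esub> f) \<and> x [^]\<^bsub>G\<^esub> E = conjugated G g (c [^]\<^bsub>G\<^esub> y))"

context group
begin

lemma inv_cancel [simp]:
  "x \<in> carrier G \<Longrightarrow> y \<in> carrier G \<Longrightarrow> inv x \<otimes> (x \<otimes> y) = y"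
  "x \<in> carrier G \<Longrightarrow> y \<in> carrier G \<Longrightarrow> x \<otimes> (inv x \<otimes> y) = y"
  by (simp_all add: m_assoc[symmetric])

lemma conjugated_closed [simp, intro]:
  "g \<in> carrier G \<Longrightarrow> x \<in> carrier G \<Longrightarrow> conjugated G g x \<in> carrier G"
  by (simp add: conjugated_def)

lemma conjugated_mult:
  "g \<in> carrier G \<Longrightarrow> x \<in> carrier G \<Longrightarrow> y \<in> carrier G \<Longrightarrow>
   conjugated G g (x \<otimes> y) = conjugated G g x \<otimes> conjugated G g y"
  by (simp add: conjugated_def m_assoc)

lemma conjugated_hom: "g \<in> carrier G \<Longrightarrow> group_hom G G (conjugated G g)"
  by (simp add: group_hom_def group_hom_axioms_def hom_def conjugated_mult is_group)

lemma conjugated_int_pow: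
  "g \<in> carrier G \<Longrightarrow> x \<in> carrier G \<Longrightarrow> conjugated G g (x [^] (z::int)) = conjugated G g x [^] z"
  using group_hom.hom_int_pow[OF conjugated_hom] by metis

lemma conjugated_nat_pow:
  "g \<in> carrier G \<Longrightarrow> x \<in> carrier G \<Longrightarrow> conjugated G g (x [^] (n::nat)) = conjugated G g x [^] n"
  using conjugated_int_pow[of g x "int n"] by (simp add: int_pow_int)

lemma conjugated_conjugated:
  "g \<in> carrier G \<Longrightarrow> h \<in> carrier G \<Longrightarrow> x \<in> carrier G \<Longrightarrow>
   conjugated G g (conjugated G h x) = conjugated G (g \<otimes> h) x"
  by (simp add: conjugated_def m_assoc inv_mult_group)

lemma conjugated_one [simp]: "x \<in> carrier G \<Longrightarrow> conjugated G \<one> x = x"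
  by (simp add: conjugated_def)

lemma conjugated_inv [simp]:
  "g \<in> carrier G \<Longrightarrow> x \<in> carrier G \<Longrightarrow> conjugated G (inv g) (conjugated G g x) = x"
  "g \<in> carrier G \<Longrightarrow> x \<in> carrier G \<Longrightarrow> conjugated G g (conjugated G (inv g) x) = x"
  by (simp_all add: conjugated_conjugated)

lemma conjugated_commute:
  "g \<in> carrier G \<Longrightarrow> x \<in> carrier G \<Longrightarrow> g \<otimes> x = x \<otimes> g \<Longrightarrow> conjugated G g x = x"
  by (simp add: conjugated_def m_assoc)

lemma conjugated_normal: "N \<lhd> G \<Longrightarrow> g \<in> carrier G \<Longrightarrow> x \<in> N \<Longrightarrow> conjugated G g x \<in> N"
  using normal.inv_op_closed2[of N G g x] by (simp add: conjugated_def)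

text \<open>B. H. Neumann's lemma. If finitely many cosets of \<open>H\<close> do not cover \<open>K\<close>, some \<open>x\<close> lies
  outside them, and for \<open>h\<close> in \<open>H \<inter> K\<close> all \<open>hx\<close> lie in cosets of the other subgroups. A translate
  of these cosets covers \<open>K \<inter> Hf\<close> for any \<open>f\<close>, so \<open>H\<close> can be dropped from the family.\<close>
lemma neumann:
  assumes fin: "finite \<H>" and sub: "\<And>H. H \<in> \<H> \<Longrightarrow> subgroup H G" and K: "subgroup K G"
    and F: "finite F" "F \<subseteq> carrier G" "\<And>y. y \<in> K \<Longrightarrow> \<exists>H\<in>\<H>. \<exists>h\<in>H. \<exists>f\<in>F. y = h \<otimes> f"
  shows "\<exists>H\<in>\<H>. \<exists>F. finite F \<and> F \<subseteq> carrier G \<and> (\<forall>y\<in>K. \<exists>h\<in>H. \<exists>f\<in>F. y = h \<otimes> f)"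
  using fin sub F
proof (induction \<H> arbitrary: F rule: finite_induct)
  case empty
  then show ?case using subgroup.one_closed[OF K] by auto
next
  case (insert H \<H>)
  show ?case
  proof (cases "\<forall>y\<in>K. \<exists>h\<in>H. \<exists>f\<in>F. y = h \<otimes> f")
    case True
    then show ?thesis using insert.prems(2,3) by auto
  next
    case False
    then obtain x where x: "x \<in> K" "\<And>h f. h \<in> H \<Longrightarrow> f \<in> F \<Longrightarrow> x \<noteq> h \<otimes> f" by blast
    have H: "subgroup H G" using insert.prems(1) by simp
    have xc: "x \<in> carrier G" using x(1) subgroup.mem_carrier[OF K] by blast
    \<comment> \<open>\<open>y0 f\<close> moves the coset \<open>Hf\<close> to a representative in \<open>K\<close>; if \<open>K \<inter> Hf\<close> is empty, its value is
      arbitrary.\<close>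
    define y0 where "y0 f = (SOME y. y \<in> K \<and> (\<exists>h\<in>H. y = h \<otimes> f))" for f
    define F' where "F' = F \<union> (\<lambda>(f', f). f' \<otimes> inv x \<otimes> y0 f) ` (F \<times> {f\<in>F. y0 f \<in> carrier G})"
    have "finite F'" "F' \<subseteq> carrier G" unfolding F'_def using insert.prems(2,3) xc by auto
    moreover have "\<exists>H'\<in>\<H>. \<exists>h\<in>H'. \<exists>f\<in>F'. y = h \<otimes> f" if y: "y \<in> K" for y
    proof -
      obtain H' h f where hf: "H' \<in> insert H \<H>" "h \<in> H'" "f \<in> F" "y = h \<otimes> f" using insert.prems(4)[OF y] by blast
      show ?thesis
      proof (cases "H' = H")
        case False
        then show ?thesis using hf unfolding F'_def by blast
      next
        case True
        have fc: "f \<in> carrier G" using hf(3) insert.prems(3) by auto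
        have "y0 f \<in> K \<and> (\<exists>h\<in>H. y0 f = h \<otimes> f)"
          unfolding y0_def by (rule someI[of _ y]) (use y hf True in blast)
        then obtain h0 where h0: "y0 f \<in> K" "h0 \<in> H" "y0 f = h0 \<otimes> f" by blast
        have hc: "h \<in> carrier G" "h0 \<in> carrier G" "y0 f \<in> carrier G"
          using True hf(2) h0 subgroup.mem_carrier[OF H] subgroup.mem_carrier[OF K] by auto
        let ?k = "h \<otimes> inv h0"
        have kH: "?k \<in> H" using True hf(2) h0(2) by (simp add: H subgroup.m_closed subgroup.m_inv_closed)
        have yk: "y = ?k \<otimes> y0 f" using hf(4) h0(3) hc fc by (simp add: m_assoc)
        have "?k = y \<otimes> inv (y0 f)" using yk hc by (simp add: m_assoc)
        then have "?k \<in> K" using y h0(1) by (simp add: K subgroup.m_closed subgroup.m_inv_closed)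
        then have "?k \<otimes> x \<in> K" using x(1) by (simp add: K subgroup.m_closed)
        then obtain H'' h' f' where h': "H'' \<in> insert H \<H>" "h' \<in> H''" "f' \<in> F" "?k \<otimes> x = h' \<otimes> f'"
          using insert.prems(4) by blast
        have f'c: "f' \<in> carrier G" using h'(3) insert.prems(3) by auto
        have h'c: "h' \<in> carrier G" using subgroup.mem_carrier[OF insert.prems(1)[OF h'(1)] h'(2)] .
        have "H'' \<noteq> H"
        proof
          assume "H'' = H"
          then have "inv ?k \<otimes> h' \<in> H" using kH h'(2) by (simp add: H subgroup.m_closed subgroup.m_inv_closed)
          moreover have "x = inv ?k \<otimes> h' \<otimes> f'"
            using h'(4) hc xc h'c f'c by (metis inv_cancel(1) inv_closed m_assoc m_closed)
          ultimately show False using x(2) h'(3) by blast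
        qed
        then have "H'' \<in> \<H>" using h'(1) by simp
        moreover have "y = h' \<otimes> (f' \<otimes> inv x \<otimes> y0 f)"
        proof -
          have "y = (?k \<otimes> x) \<otimes> inv x \<otimes> y0 f" using yk hc xc by (simp add: m_assoc)
          then show ?thesis using h'(4) h'c f'c xc hc by (simp add: m_assoc)
        qed
        moreover have "f' \<otimes> inv x \<otimes> y0 f \<in> F'" unfolding F'_def using h'(3) hf(3) hc(3) by force
        ultimately show ?thesis using h'(2) by blast
      qed
    qed
    ultimately show ?thesis using insert.IH[of F'] insert.prems(1) by (metis insertCI)
  qed
qed

text \<open>The finitely many representatives of \<open>S\<close> in \<open>G\<close> are absorbed into the covering family.\<close>
lemma vc_cover_reduce:
  assumes cov: "vc_cover G (carrier G) P E" and S: "S \<subseteq> carrier G"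
    and F: "finite F" "F \<subseteq> carrier G" "\<And>g. g \<in> carrier G \<Longrightarrow> \<exists>s\<in>S. \<exists>f\<in>F. g = s \<otimes> f"
  shows "\<exists>P'. vc_cover G S P' E"
proof -
  have P: "finite P" "P \<subseteq> carrier G \<times> carrier G" "0 < E" using cov by (auto simp: vc_cover_def)
  define P' where "P' = (\<lambda>((c, f), r). (conjugated G r c, conjugated G r f)) ` (P \<times> F)"
  have P': "finite P'" "P' \<subseteq> carrier G \<times> carrier G" unfolding P'_def using P F(1,2) by auto
  have "\<exists>(c, f)\<in>P'. \<exists>g\<in>S. \<exists>(z::int) (y::int).
        x = conjugated G g (c [^] z \<otimes> f) \<and> x [^] E = conjugated G g (c [^] y)" if x: "x \<in> carrier G" for x
  proof -
    obtain c f g and z y :: int where h: "(c, f) \<in> P" "g \<in> carrier G"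
        "x = conjugated G g (c [^] z \<otimes> f)" "x [^] E = conjugated G g (c [^] y)"
      using cov x unfolding vc_cover_def by blast
    obtain s r where sr: "s \<in> S" "r \<in> F" "g = s \<otimes> r" using F(3)[OF h(2)] by blast
    have cl: "c \<in> carrier G" "f \<in> carrier G" "s \<in> carrier G" "r \<in> carrier G"
      using h(1) P(2) sr S F(2) by auto
    have "x = conjugated G s ((conjugated G r c) [^] z \<otimes> conjugated G r f)"
      "x [^] E = conjugated G s ((conjugated G r c) [^] y)"
      using h(3,4) sr(3) cl by (simp_all add: conjugated_conjugated[symmetric] conjugated_mult conjugated_int_pow)
    moreover have "(conjugated G r c, conjugated G r f) \<in> P'" unfolding P'_def using h(1) sr(2) by force
    ultimately show ?thesis using sr(1) by blast
  qed
  then show ?thesis using P' P(3) unfolding vc_cover_def by blast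
qed

lemma cyclic_subgroup:
  assumes c: "c \<in> carrier G"
  shows "subgroup (range (\<lambda>z::int. c [^] z)) G"
proof -
  have "inv (c [^] z) = c [^] (- z)" "c [^] z \<otimes> c [^] y = c [^] (z + y)" for z y :: int
    using c by (simp_all add: int_pow_neg int_pow_mult)
  then show ?thesis using c by (intro subgroupI) auto
qed

text \<open>After the reduction the covering groups are only conjugated by elements of \<open>A\<close>, which act
  trivially on \<open>A\<close>. So \<open>A\<close> is a finite union of pieces of cosets of cyclic groups, and Neumann's
  lemma applies.\<close>
lemma abelian_finite_index_vc:
  assumes A: "A \<lhd> G" and comm: "\<And>x y. x \<in> A \<Longrightarrow> y \<in> A \<Longrightarrow> x \<otimes> y = y \<otimes> x"
    and F: "finite F" "F \<subseteq> carrier G" "\<And>g. g \<in> carrier G \<Longrightarrow> \<exists>a\<in>A. \<exists>f\<in>F. g = a \<otimes> f"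
    and cov: "vc_cover G (carrier G) P E"
  shows "vc_mod G {\<one>}"
proof -
  have sA: "subgroup A G" using A by (rule normal_imp_subgroup)
  note Ac = subgroup.mem_carrier[OF sA]
  obtain Q where Q: "vc_cover G A Q E"
    using vc_cover_reduce[OF cov subgroup.subset[OF sA] F] by blast
  then have Qc: "finite Q" "Q \<subseteq> carrier G \<times> carrier G" by (auto simp: vc_cover_def)
  define \<H> where "\<H> = (\<lambda>c. range (\<lambda>z::int. c [^] z)) ` fst ` Q"
  have "\<exists>H\<in>\<H>. \<exists>F. finite F \<and> F \<subseteq> carrier G \<and> (\<forall>y\<in>A. \<exists>h\<in>H. \<exists>f\<in>F. y = h \<otimes> f)"
  proof (rule neumann[of _ _ "snd ` Q"])
    show "finite \<H>" "finite (snd ` Q)" unfolding \<H>_def using Qc by auto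
    show "subgroup H G" if "H \<in> \<H>" for H using that cyclic_subgroup Qc(2) unfolding \<H>_def by auto
    show "subgroup A G" by (rule sA)
    show "snd ` Q \<subseteq> carrier G" using Qc by auto
    show "\<exists>H\<in>\<H>. \<exists>h\<in>H. \<exists>f\<in>snd ` Q. x = h \<otimes> f" if x: "x \<in> A" for x
    proof -
      obtain c f a and z :: int where h: "(c, f) \<in> Q" "a \<in> A" "x = conjugated G a (c [^] z \<otimes> f)"
        using Q Ac[OF x] unfolding vc_cover_def by blast
      have cl: "c \<in> carrier G" "f \<in> carrier G" using h(1) Qc(2) by auto
      have ia: "inv a \<in> A" using subgroup.m_inv_closed[OF sA h(2)] .
      have "conjugated G (inv a) x = x"
        using conjugated_commute[of "inv a" x] comm[OF ia x] Ac ia x by simp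
      then have e: "x = c [^] z \<otimes> f" using h(3) cl Ac[OF h(2)] by simp
      have 1: "range (\<lambda>z::int. c [^] z) \<in> \<H>" unfolding \<H>_def using h(1) by force
      have 2: "f \<in> snd ` Q" using h(1) by force
      have "\<exists>h\<in>range (\<lambda>z::int. c [^] z). \<exists>f\<in>snd ` Q. x = h \<otimes> f" using e 2 by blast
      then show ?thesis by (rule bexI[OF _ 1])
    qed
  qed
  then obtain H F' where H: "H \<in> \<H>" "finite F'" "F' \<subseteq> carrier G"
    "\<And>y. y \<in> A \<Longrightarrow> \<exists>h\<in>H. \<exists>f\<in>F'. y = h \<otimes> f" by blast
  from H(1) obtain c where "c \<in> fst ` Q" "H = range (\<lambda>z::int. c [^] z)" unfolding \<H>_def by blast
  with H have c: "c \<in> fst ` Q" "finite F'" "F' \<subseteq> carrier G"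
    "\<And>y. y \<in> A \<Longrightarrow> \<exists>h\<in>range (\<lambda>z::int. c [^] z). \<exists>f\<in>F'. y = h \<otimes> f" by simp_all
  have cc: "c \<in> carrier G" using c(1) Qc(2) by auto
  define F'' where "F'' = (\<lambda>(f', f). f' \<otimes> f) ` (F' \<times> F)"
  have "\<exists>n\<in>{\<one>}. \<exists>k::int. \<exists>f\<in>F''. x = n \<otimes> c [^] k \<otimes> f" if x: "x \<in> carrier G" for x
  proof -
    obtain a f where a: "a \<in> A" "f \<in> F" "x = a \<otimes> f" using F(3)[OF x] by blast
    obtain f' and k :: int where f': "f' \<in> F'" "a = c [^] k \<otimes> f'" using c(4)[OF a(1)] by blast
    have "f \<in> carrier G" "f' \<in> carrier G" using a(2) f'(1) F(2) c(3) by auto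
    then have "x = \<one> \<otimes> c [^] k \<otimes> (f' \<otimes> f)" using a(3) f'(2) cc by (simp add: m_assoc)
    moreover have "f' \<otimes> f \<in> F''" unfolding F''_def using f'(1) a(2) by force
    ultimately show ?thesis by blast
  qed
  moreover have "finite F''" "F'' \<subseteq> carrier G" unfolding F''_def using c(2,3) F(1,2) by auto
  ultimately show ?thesis unfolding vc_mod_def using cc by blast
qed

end

lemma (in group) rcos_eq_iff:
  assumes N: "subgroup N G" and x: "x \<in> carrier G" and y: "y \<in> carrier G"
  shows "N #> x = N #> y \<longleftrightarrow> x \<otimes> inv y \<in> N"
proof -
  have "x \<otimes> inv y \<in> N \<longleftrightarrow> x \<in> N #> y" using subgroup.rcos_module[OF N is_group y x] by simp
  also have "\<dots> \<longleftrightarrow> N #> x = N #> y"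
    using repr_independence[OF _ y N] rcos_self[OF x N] by blast
  finally show ?thesis by simp
qed

lemma (in group) pow_mod_normal:
  assumes A: "A \<lhd> G" and x: "x \<in> carrier G" and t: "t \<in> carrier G" and h: "x \<otimes> inv t \<in> A"
  shows "x [^] (n::int) \<otimes> inv (t [^] n) \<in> A"
proof -
  interpret A: normal A G by (rule A)
  have "A #> x [^] n = A #> t [^] n"
    using A.FactGroup_int_pow[OF x, of n] A.FactGroup_int_pow[OF t, of n] rcos_eq_iff[OF A.is_subgroup x t] h by simp
  then show ?thesis using rcos_eq_iff[OF A.is_subgroup, of "x [^] n" "t [^] n"] x t by simp
qed

text \<open>Here the module theory is applied to the conjugation action \<open>T\<close> of \<open>\<langle>t\<rangle>\<close> on \<open>A\<close>. For the
  condition on the cosets \<open>At\<^sup>k\<close>: if \<open>y\<close> in \<open>\<langle>c\<rangle>f \<inter> At\<^sup>k\<close> has a power in \<open>\<langle>c\<rangle>\<close>, then \<open>\<langle>c\<rangle>\<close> contains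
  an element of infinite order modulo \<open>A\<close> and so meets \<open>A\<close> trivially; thus \<open>\<langle>c\<rangle>f\<close> has only one
  such element. So each coset \<open>At\<^sup>k\<close> has at most one conjugacy class for every member of the cover,
  whatever \<open>k\<close> is.\<close>
lemma (in group) abelian_kernel_finite:
  assumes A: "A \<lhd> G" and comm: "\<And>x y. x \<in> A \<Longrightarrow> y \<in> A \<Longrightarrow> x \<otimes> y = y \<otimes> x"
    and t: "t \<in> carrier G" and inf: "\<And>k::int. t [^] k \<in> A \<Longrightarrow> k = 0"
    and cov: "vc_cover G {a \<otimes> t [^] (k::int) | a k. a \<in> A} P E"
  shows "finite A"
proof -
  have sA: "subgroup A G" using A by (rule normal_imp_subgroup)
  note Ac = subgroup.mem_carrier[OF sA]
  have P: "finite P" "P \<subseteq> carrier G \<times> carrier G" "0 < E" using cov by (auto simp: vc_cover_def)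
  let ?A = "G\<lparr>carrier := A\<rparr>"
  define T where "T k a = conjugated G (t [^] k) a" for k :: int and a
  have TA: "T k a \<in> A" if "a \<in> A" for k a using conjugated_normal[OF A _ that] t by (simp add: T_def)
  have Tadd: "T (k + l) x = T k (T l x)" if "x \<in> carrier G" for k l x
    using that t by (simp add: T_def conjugated_conjugated int_pow_mult)
  have T0: "T 0 x = x" if "x \<in> carrier G" for x using that by (simp add: T_def)
  have conjA: "conjugated G a x = x" if "a \<in> A" "x \<in> A" for a x
    using conjugated_commute[OF Ac[OF that(1)] Ac[OF that(2)] comm[OF that]] .
  interpret A: group ?A using subgroup.subgroup_is_group[OF sA is_group] .
  have cA: "comm_group ?A" using comm by (intro A.group_comm_groupI) simp
  interpret M: int_module ?A T
  proof (rule int_module.intro[OF cA], unfold_locales)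
    show "T k \<in> hom ?A ?A" for k using TA Ac t by (auto simp: hom_def T_def conjugated_mult)
  qed (use T0 Tadd Ac in auto)
  have powA: "x [^]\<^bsub>?A\<^esub> (z::int) = x [^] z" if "x \<in> A" for x z
    using int_pow_consistent[OF sA that] by simp
  have npowA: "x [^]\<^bsub>?A\<^esub> (n::nat) = x [^] n" for x n
    using nat_pow_consistent[of x n A] by simp
  have invA: "inv\<^bsub>?A\<^esub> x = inv x" if "x \<in> A" for x using m_inv_consistent[OF sA that] .

  text \<open>The covering cosets may have representatives outside \<open>A\<close>. As \<open>\<langle>c\<rangle> \<inter> A\<close> is cyclic, the part
    of \<open>\<langle>c\<rangle>f\<close> inside \<open>A\<close> is again a coset of a cyclic group, now with both representatives in
    \<open>A\<close>.\<close>
  have "\<exists>c'\<in>A. \<exists>f'\<in>A. \<forall>z::int. (c [^] z \<in> A \<longrightarrow> (\<exists>y::int. c [^] z = c' [^] y)) \<and>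
      (c [^] z \<otimes> f \<in> A \<longrightarrow> (\<exists>y::int. c [^] z \<otimes> f = c' [^] y \<otimes> f'))"
    if cf: "c \<in> carrier G" "f \<in> carrier G" for c f
  proof -
    have "k - l \<in> {z::int. c [^] z \<in> A}" if "k \<in> {z::int. c [^] z \<in> A}" "l \<in> {z::int. c [^] z \<in> A}" for k l
      using that cf(1) by (simp add: int_pow_diff sA subgroup.m_closed subgroup.m_inv_closed)
    then obtain s :: int where s: "c [^] s \<in> A" "\<And>z. c [^] z \<in> A \<Longrightarrow> s dvd z"
      using int_subgroup_principal[of "{z::int. c [^] z \<in> A}"] subgroup.one_closed[OF sA] by auto
    have 1: "\<exists>y::int. c [^] z = (c [^] s) [^] y" if "c [^] z \<in> A" for z :: int
      using s(2)[OF that] cf(1) by (auto simp: int_pow_pow elim!: dvdE)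
    show ?thesis
    proof (cases "\<exists>z0::int. c [^] z0 \<otimes> f \<in> A")
      case False
      then show ?thesis using s(1) 1 subgroup.one_closed[OF sA] by blast
    next
      case True
      then obtain z0 :: int where z0: "c [^] z0 \<otimes> f \<in> A" by blast
      have "\<exists>y::int. c [^] z \<otimes> f = (c [^] s) [^] y \<otimes> (c [^] z0 \<otimes> f)" if z: "c [^] z \<otimes> f \<in> A" for z :: int
      proof -
        have "(c [^] z \<otimes> f) \<otimes> inv (c [^] z0 \<otimes> f) = c [^] (z - z0)"
          using cf by (simp add: inv_mult_group m_assoc int_pow_diff)
        then have "c [^] (z - z0) \<in> A"
          using subgroup.m_closed[OF sA z subgroup.m_inv_closed[OF sA z0]] by simp
        then obtain y :: int where y: "c [^] (z - z0) = (c [^] s) [^] y" using 1 by blast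
        have "c [^] z \<otimes> f = c [^] (z - z0) \<otimes> (c [^] z0 \<otimes> f)"
          using cf by (simp add: m_assoc[symmetric] int_pow_mult[symmetric])
        then show ?thesis using y by auto
      qed
      then show ?thesis using s(1) 1 z0 by blast
    qed
  qed
  then obtain C F where CF: "\<And>c f. c \<in> carrier G \<Longrightarrow> f \<in> carrier G \<Longrightarrow> C c f \<in> A \<and> F c f \<in> A \<and>
      (\<forall>z::int. (c [^] z \<in> A \<longrightarrow> (\<exists>y::int. c [^] z = C c f [^] y)) \<and>
      (c [^] z \<otimes> f \<in> A \<longrightarrow> (\<exists>y::int. c [^] z \<otimes> f = C c f [^] y \<otimes> F c f)))"
    by metis
  define Q where "Q = (\<lambda>(c, f). (C c f, F c f)) ` P"

  have "finite (carrier ?A)"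
  proof (rule M.finite_carrier[of Q E P])
    show "finite Q" "finite P" "0 < E" using P by (auto simp: Q_def)
    show "Q \<subseteq> carrier ?A \<times> carrier ?A" using P(2) CF by (auto simp: Q_def)
  next
    fix x assume "x \<in> carrier ?A"
    then have x: "x \<in> A" by simp
    obtain c f a k and z y :: int where h: "(c, f) \<in> P" "a \<in> A"
        "x = conjugated G (a \<otimes> t [^] (k::int)) (c [^] z \<otimes> f)"
        "x [^] E = conjugated G (a \<otimes> t [^] k) (c [^] y)"
      using cov Ac[OF x] unfolding vc_cover_def by blast
    have cf: "c \<in> carrier G" "f \<in> carrier G" using h(1) P(2) by auto
    have eq: "w = T k v \<and> v \<in> A" if w: "w \<in> A" and v: "v \<in> carrier G" "w = conjugated G (a \<otimes> t [^] k) v" for v w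
    proof -
      have "conjugated G (inv a) w = T k v"
        using v Ac[OF h(2)] t by (simp add: T_def conjugated_conjugated[symmetric])
      then have "w = T k v" using conjA[OF subgroup.m_inv_closed[OF sA h(2)] w] by simp
      moreover have "v = T (- k) (T k v)" using Tadd[OF v(1), of "-k" k] T0[OF v(1)] by simp
      ultimately show ?thesis using TA[OF w] by metis
    qed
    have 1: "x = T k (c [^] z \<otimes> f)" "c [^] z \<otimes> f \<in> A" using eq[OF x _ h(3)] cf by auto
    have "x [^] E \<in> A" using subgroup_int_pow_closed[OF sA x, of "int E"] by (simp add: int_pow_int)
    then have 2: "x [^] E = T k (c [^] y)" "c [^] y \<in> A" using eq[OF _ _ h(4)] cf by auto
    note CF' = CF[OF cf]
    obtain z' y' :: int where "c [^] z \<otimes> f = C c f [^] z' \<otimes> F c f" "c [^] y = C c f [^] y'"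
      using CF' 1(2) 2(2) by blast
    moreover have "(C c f, F c f) \<in> Q" using h(1) by (force simp: Q_def)
    ultimately show "\<exists>(c, f)\<in>Q. \<exists>k. \<exists>(z::int) (y::int).
        x = T k (c [^]\<^bsub>?A\<^esub> z \<otimes>\<^bsub>?A\<^esub> f) \<and> x [^]\<^bsub>?A\<^esub> E = T k (c [^]\<^bsub>?A\<^esub> y)"
      using 1(1) 2(1) CF' by (intro bexI[of _ "(C c f, F c f)"]) (auto simp: powA npowA)
  next
    fix k :: int assume k: "0 < k"
    define good where "good c f y \<longleftrightarrow> (\<exists>(z::int) (w::int). y = c [^] z \<otimes> f \<and> y \<otimes> inv (t [^] k) \<in> A \<and> y [^] E = c [^] w)"
      for c f y
    \<comment> \<open>The coset \<open>\<langle>c\<rangle>f\<close> meets \<open>At\<^sup>k\<close> in one relevant point: \<open>yy'\<^sup>-\<^sup>1 = c\<^sup>m\<close> lies in \<open>A\<close>, hence so does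
      \<open>c\<^sup>m\<^sup>w = y\<^sup>E\<^sup>m\<close>, which is \<open>t\<^sup>k\<^sup>E\<^sup>m\<close> modulo \<open>A\<close>.\<close>
    have unique: "y = y'" if cf: "c \<in> carrier G" "f \<in> carrier G" and g: "good c f y" "good c f y'" for c f y y'
    proof -
      obtain z w z' :: int where h: "y = c [^] z \<otimes> f" "y \<otimes> inv (t [^] k) \<in> A" "y [^] E = c [^] w"
        "y' = c [^] z' \<otimes> f" "y' \<otimes> inv (t [^] k) \<in> A" using g unfolding good_def by blast
      have yc: "y \<in> carrier G" "y' \<in> carrier G" using h cf by auto
      define m where "m = z - z'"
      have "(y \<otimes> inv (t [^] k)) \<otimes> inv (y' \<otimes> inv (t [^] k)) = c [^] m"
        using h(1,4) cf t by (simp add: inv_mult_group m_assoc int_pow_diff m_def)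
      then have "c [^] m \<in> A"
        using subgroup.m_closed[OF sA h(2) subgroup.m_inv_closed[OF sA h(5)]] by simp
      then have "(c [^] m) [^] w \<in> A" using subgroup_int_pow_closed[OF sA] by blast
      moreover have "(c [^] m) [^] w = y [^] (int E * m)"
      proof -
        have "(c [^] m) [^] w = (c [^] w) [^] m" using cf by (simp add: int_pow_pow mult.commute)
        also have "\<dots> = (y [^] int E) [^] m" using h(3) by (simp only: int_pow_int)
        also have "\<dots> = y [^] (int E * m)" by (rule int_pow_pow[OF yc(1)])
        finally show ?thesis .
      qed
      ultimately have "y [^] (int E * m) \<in> A" by simp
      then have "inv (y [^] (int E * m) \<otimes> inv ((t [^] k) [^] (int E * m))) \<otimes> y [^] (int E * m) \<in> A"
        using pow_mod_normal[OF A yc(1) _ h(2), of "int E * m"] t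
        by (simp add: sA subgroup.m_closed subgroup.m_inv_closed)
      then have "t [^] (k * (int E * m)) \<in> A" using yc t by (simp add: inv_mult_group m_assoc int_pow_pow)
      then have "m = 0" using inf[of "k * (int E * m)"] k P(3) by simp
      then show ?thesis using h(1,4) by (simp add: m_def)
    qed
    define \<sigma> where "\<sigma> = (\<lambda>(c, f). (SOME y. good c f y) \<otimes> inv (t [^] k))"
    have "\<exists>i\<in>P. \<sigma> i \<in> A \<and> (\<exists>j. \<exists>b\<in>A. a = T j (\<sigma> i \<otimes> (b \<otimes> inv (T k b))))" if a: "a \<in> A" for a
    proof -
      define x where "x = a \<otimes> t [^] k"
      have xc: "x \<in> carrier G" using Ac[OF a] t by (simp add: x_def)
      obtain c f a' j and z w :: int where h: "(c, f) \<in> P" "a' \<in> A"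
          "x = conjugated G (a' \<otimes> t [^] (j::int)) (c [^] z \<otimes> f)"
          "x [^] E = conjugated G (a' \<otimes> t [^] j) (c [^] w)"
        using cov xc unfolding vc_cover_def by blast
      have cf: "c \<in> carrier G" "f \<in> carrier G" using h(1) P(2) by auto
      define g where "g = a' \<otimes> t [^] j"
      define y where "y = c [^] z \<otimes> f"
      define b where "b = T (- j) a'"
      have cl: "g \<in> carrier G" "y \<in> carrier G" "a' \<in> carrier G" using Ac[OF h(2)] t cf by (auto simp: g_def y_def)
      have b: "b \<in> A" "b \<in> carrier G" using TA[OF h(2)] Ac by (auto simp: b_def)
      have g: "g = t [^] j \<otimes> b"
        using cl t by (simp add: g_def b_def T_def conjugated_def int_pow_neg m_assoc)
      have y: "y = conjugated G (inv g) x" using h(3) cl by (simp add: g_def[symmetric] y_def[symmetric])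
      have "y [^] E = conjugated G (inv g) (x [^] E)" using y cl xc by (simp add: conjugated_nat_pow)
      then have yE: "y [^] E = c [^] w" using h(4) cl cf by (simp add: g_def[symmetric])
      have tk: "conjugated G (t [^] j) (t [^] k) = t [^] k"
        using t by (intro conjugated_commute) (simp_all add: int_pow_mult[symmetric] add.commute)
      have tk': "conjugated G (inv (t [^] j)) (t [^] k) = t [^] k"
        using conjugated_inv(1)[of "t [^] j" "t [^] k"] tk t by simp
      define u where "u = y \<otimes> inv (t [^] k)"
      have "conjugated G (inv g) x = conjugated G (inv g) a \<otimes> conjugated G (inv g) (t [^] k)"
        using cl Ac[OF a] t by (simp add: x_def conjugated_mult)
      also have "conjugated G (inv g) (t [^] k) = conjugated G (inv b) (t [^] k)"
        using tk' b t by (simp add: g inv_mult_group conjugated_conjugated[symmetric])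
      also have "\<dots> = (inv b \<otimes> T k b) \<otimes> t [^] k"
        using b t by (simp add: conjugated_def T_def m_assoc)
      finally have "u = conjugated G (inv g) a \<otimes> (inv b \<otimes> T k b)"
        using cl Ac[OF a] b Ac[OF TA[OF b(1), of k]] t by (simp add: u_def y m_assoc)
      then have u: "u \<in> A"
        using conjugated_normal[OF A _ a, of "inv g"] cl TA[OF b(1)] b(1)
        by (simp add: sA subgroup.m_closed subgroup.m_inv_closed)
      have "good c f y" unfolding good_def using u yE by (auto simp: u_def y_def)
      then have "(SOME y. good c f y) = y" using unique[OF cf] by (metis someI)
      then have \<sigma>: "\<sigma> (c, f) = u" by (simp add: \<sigma>_def u_def)
      \<comment> \<open>Conjugating \<open>ut\<^sup>k\<close> by \<open>b\<close> multiplies \<open>u\<close> by an element of \<open>(1 - t\<^sup>k)A\<close>; conjugating by \<open>t\<^sup>j\<close>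
        applies \<open>T j\<close>.\<close>
      have "x = conjugated G (t [^] j) (conjugated G b y)"
        using h(3) g b cl t by (simp add: g_def[symmetric] y_def[symmetric] conjugated_conjugated)
      also have "conjugated G b y = (u \<otimes> (b \<otimes> inv (T k b))) \<otimes> t [^] k"
      proof -
        have "conjugated G b y = b \<otimes> u \<otimes> (t [^] k \<otimes> inv b)"
          using b cl t by (simp add: conjugated_def u_def m_assoc)
        also have "b \<otimes> u = u \<otimes> b" using comm b u by blast
        also have "t [^] k \<otimes> inv b = inv (T k b) \<otimes> t [^] k"
          using b t by (simp add: T_def conjugated_def inv_mult_group m_assoc)
        finally show ?thesis using b Ac[OF u] Ac[OF TA[OF b(1), of k]] t by (simp add: m_assoc)
      qed
      also have "conjugated G (t [^] j) \<dots> = T j (u \<otimes> (b \<otimes> inv (T k b))) \<otimes> t [^] k"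
        using b Ac[OF u] Ac[OF TA[OF b(1), of k]] t tk by (simp add: conjugated_mult[of "t [^] j" _ "t [^] k"] T_def)
      finally have "a \<otimes> t [^] k = T j (u \<otimes> (b \<otimes> inv (T k b))) \<otimes> t [^] k" by (simp add: x_def)
      moreover have "T j (u \<otimes> (b \<otimes> inv (T k b))) \<in> carrier G"
        using b Ac[OF u] Ac[OF TA[OF b(1), of k]] t by (simp add: T_def)
      ultimately have "a = T j (u \<otimes> (b \<otimes> inv (T k b)))" using Ac[OF a] t by simp
      then show ?thesis using h(1) \<sigma> u b(1) by (intro bexI[of _ "(c, f)"]) auto
    qed
    then show "\<exists>\<sigma>. \<forall>a\<in>carrier ?A. \<exists>i\<in>P. \<sigma> i \<in> carrier ?A \<and>
        (\<exists>j. \<exists>b\<in>carrier ?A. a = T j (\<sigma> i \<otimes>\<^bsub>?A\<^esub> (b \<otimes>\<^bsub>?A\<^esub> inv\<^bsub>?A\<^esub> T k b)))"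
      by (intro exI[of _ \<sigma>]) (simp add: invA TA cong: bex_cong)
  qed
  then show ?thesis by simp
qed

text \<open>If some \<open>t\<^sup>q\<close> with \<open>q > 0\<close> lies in \<open>A\<close>, then \<open>A\<close> has finite index; otherwise \<open>A\<close> is finite,
  and then the cyclic subgroup generated by \<open>t\<close> has finite index.\<close>
lemma (in group) abelian_extension_vc:
  assumes A: "A \<lhd> G" and comm: "\<And>x y. x \<in> A \<Longrightarrow> y \<in> A \<Longrightarrow> x \<otimes> y = y \<otimes> x"
    and vc: "vc_mod G A" and cov: "vc_cover G (carrier G) P E"
  shows "vc_mod G {\<one>}"
proof -
  have sA: "subgroup A G" using A by (rule normal_imp_subgroup)
  note Ac = subgroup.mem_carrier[OF sA]
  obtain t F where t: "t \<in> carrier G" and F: "finite F" "F \<subseteq> carrier G"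
    "\<And>x. x \<in> carrier G \<Longrightarrow> \<exists>a\<in>A. \<exists>k::int. \<exists>f\<in>F. x = a \<otimes> t [^] k \<otimes> f"
    using vc unfolding vc_mod_def by blast
  show ?thesis
  proof (cases "\<exists>q::int>0. t [^] q \<in> A")
    case True
    then obtain q :: int where q: "0 < q" "t [^] q \<in> A" by blast
    define F' where "F' = (\<lambda>(i, f). t [^] i \<otimes> f) ` ({0..<q} \<times> F)"
    have "\<exists>a\<in>A. \<exists>f\<in>F'. x = a \<otimes> f" if x: "x \<in> carrier G" for x
    proof -
      obtain a f and k :: int where h: "a \<in> A" "f \<in> F" "x = a \<otimes> t [^] k \<otimes> f" using F(3)[OF x] by blast
      have fc: "f \<in> carrier G" using h(2) F(2) by auto
      let ?b = "(t [^] q) [^] (k div q)"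
      have b: "?b \<in> A" using subgroup_int_pow_closed[OF sA q(2)] .
      have "t [^] k = ?b \<otimes> t [^] (k mod q)" using t by (simp add: int_pow_pow int_pow_mult[symmetric])
      then have "x = (a \<otimes> ?b) \<otimes> (t [^] (k mod q) \<otimes> f)" using h(3) Ac[OF h(1)] fc t by (simp add: m_assoc)
      moreover have "t [^] (k mod q) \<otimes> f \<in> F'"
        unfolding F'_def using h(2) q(1) by (intro image_eqI[of _ _ "(k mod q, f)"]) auto
      ultimately show ?thesis using subgroup.m_closed[OF sA h(1) b] by blast
    qed
    moreover have "finite F'" "F' \<subseteq> carrier G" unfolding F'_def using F(1,2) t by auto
    ultimately show ?thesis using abelian_finite_index_vc[OF A comm _ _ _ cov, of F'] by blast
  next
    case False
    have inf: "k = 0" if k: "t [^] k \<in> A" for k :: int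
    proof (rule ccontr)
      assume "k \<noteq> 0"
      moreover have "t [^] (- k) \<in> A" using subgroup.m_inv_closed[OF sA k] t by (simp add: int_pow_neg)
      ultimately show False using False k by (cases "0 < k") auto
    qed
    let ?S = "{a \<otimes> t [^] (k::int) | a k. a \<in> A}"
    have "?S \<subseteq> carrier G" using Ac t by auto
    moreover have "\<exists>s\<in>?S. \<exists>f\<in>F. x = s \<otimes> f" if "x \<in> carrier G" for x using F(3)[OF that] by blast
    ultimately obtain Q where "vc_cover G ?S Q E" using vc_cover_reduce[OF cov _ F(1,2), of ?S] by blast
    then have finA: "finite A" using abelian_kernel_finite[OF A comm t inf] by blast
    define F' where "F' = (\<lambda>(a, f). a \<otimes> f) ` (A \<times> F)"
    have "\<exists>n\<in>{\<one>}. \<exists>k::int. \<exists>f\<in>F'. x = n \<otimes> t [^] k \<otimes> f" if x: "x \<in> carrier G" for x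
    proof -
      obtain a f and k :: int where h: "a \<in> A" "f \<in> F" "x = a \<otimes> t [^] k \<otimes> f" using F(3)[OF x] by blast
      have fc: "f \<in> carrier G" using h(2) F(2) by auto
      let ?b = "conjugated G (inv (t [^] k)) a"
      have "?b \<in> A" using conjugated_normal[OF A _ h(1)] t by simp
      then have "?b \<otimes> f \<in> F'" unfolding F'_def using h(2) by (intro image_eqI[of _ _ "(?b, f)"]) auto
      moreover have "x = \<one> \<otimes> t [^] k \<otimes> (?b \<otimes> f)"
        using h(3) Ac[OF h(1)] fc t by (simp add: conjugated_def m_assoc)
      ultimately show ?thesis by blast
    qed
    moreover have "finite F'" "F' \<subseteq> carrier G" unfolding F'_def using F(1,2) finA Ac by auto
    ultimately show ?thesis unfolding vc_mod_def using t by blast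
  qed
qed

section \<open>Descending along a normal series\<close>

lemma vc_cover_quotient:
  assumes G: "group G" and N: "N \<lhd> G" and cov: "vc_cover G (carrier G) P E"
  shows "\<exists>P. vc_cover (G Mod N) (carrier (G Mod N)) P E"
proof -
  interpret G: group G by (rule G)
  interpret N: normal N G by (rule N)
  let ?Q = "G Mod N"
  interpret H: group "G Mod N" by (rule N.factorgroup_is_group)
  let ?p = "\<lambda>x. N #>\<^bsub>G\<^esub> x"
  interpret p: group_hom G "G Mod N" ?p
    by (simp add: group_hom_def group_hom_axioms_def N.r_coset_hom_Mod G H.is_group)
  have conj: "?p (conjugated G g x) = conjugated (G Mod N) (?p g) (?p x)"
    if "g \<in> carrier G" "x \<in> carrier G" for g x
    unfolding conjugated_def using that by (simp only: p.hom_mult p.hom_inv G.m_closed G.inv_closed)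
  have P: "finite P" "P \<subseteq> carrier G \<times> carrier G" "0 < E" using cov by (auto simp: vc_cover_def)
  let ?P = "map_prod ?p ?p ` P"
  have "\<exists>(c, f)\<in>?P. \<exists>g\<in>carrier (G Mod N). \<exists>(z::int) (y::int).
      U = conjugated (G Mod N) g (c [^]\<^bsub>?Q\<^esub> z \<otimes>\<^bsub>?Q\<^esub> f) \<and>
      U [^]\<^bsub>?Q\<^esub> E = conjugated (G Mod N) g (c [^]\<^bsub>?Q\<^esub> y)"
    if U: "U \<in> carrier (G Mod N)" for U
  proof -
    obtain x where x: "x \<in> carrier G" "U = ?p x" using U by (auto simp: carrier_FactGroup)
    obtain c f g and z y :: int where h: "(c, f) \<in> P" "g \<in> carrier G"
        "x = conjugated G g (c [^]\<^bsub>G\<^esub> z \<otimes>\<^bsub>G\<^esub> f)" "x [^]\<^bsub>G\<^esub> E = conjugated G g (c [^]\<^bsub>G\<^esub> y)"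
      using cov x(1) unfolding vc_cover_def by blast
    have cf: "c \<in> carrier G" "f \<in> carrier G" using h(1) P(2) by auto
    have 1: "U = conjugated (G Mod N) (?p g) (?p c [^]\<^bsub>?Q\<^esub> z \<otimes>\<^bsub>?Q\<^esub> ?p f)"
      unfolding x(2) h(3) using conj h(2) cf
      by (simp only: p.hom_mult p.hom_int_pow G.m_closed G.int_pow_closed)
    have "U [^]\<^bsub>?Q\<^esub> E = ?p (x [^]\<^bsub>G\<^esub> E)" unfolding x(2) using p.hom_nat_pow[OF x(1)] by simp
    then have 2: "U [^]\<^bsub>?Q\<^esub> E = conjugated (G Mod N) (?p g) (?p c [^]\<^bsub>?Q\<^esub> y)"
      unfolding h(4) using conj h(2) cf by (simp only: p.hom_int_pow G.int_pow_closed)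
    have mem: "(?p c, ?p f) \<in> ?P" using h(1) by force
    have "\<exists>g\<in>carrier (G Mod N). \<exists>(z::int) (y::int).
        U = conjugated (G Mod N) g (?p c [^]\<^bsub>?Q\<^esub> z \<otimes>\<^bsub>?Q\<^esub> ?p f) \<and>
        U [^]\<^bsub>?Q\<^esub> E = conjugated (G Mod N) g (?p c [^]\<^bsub>?Q\<^esub> y)"
      by (rule bexI[OF _ p.hom_closed[OF h(2)]], rule exI, rule exI, rule conjI, rule 1, rule 2)
    then show ?thesis by (intro bexI[OF _ mem]) (simp only: case_prod_conv)
  qed
  then have "vc_cover (G Mod N) (carrier (G Mod N)) ?P E"
    unfolding vc_cover_def using P by (auto simp del: mult_FactGroup)
  then show ?thesis by blast
qed

lemma vc_mod_lift:
  assumes G: "group G" and N: "N \<lhd> G" and vc: "vc_mod (G Mod N) {\<one>\<^bsub>G Mod N\<^esub>}"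
  shows "vc_mod G N"
proof -
  interpret G: group G by (rule G)
  interpret N: normal N G by (rule N)
  let ?Q = "G Mod N"
  interpret H: group "G Mod N" by (rule N.factorgroup_is_group)
  let ?p = "\<lambda>x. N #>\<^bsub>G\<^esub> x"
  interpret p: group_hom G "G Mod N" ?p
    by (simp add: group_hom_def group_hom_axioms_def N.r_coset_hom_Mod G H.is_group)
  obtain T F where T: "T \<in> carrier (G Mod N)" and F: "finite F" "F \<subseteq> carrier (G Mod N)"
    "\<And>U. U \<in> carrier (G Mod N) \<Longrightarrow> \<exists>k::int. \<exists>f\<in>F. U = \<one>\<^bsub>?Q\<^esub> \<otimes>\<^bsub>?Q\<^esub> T [^]\<^bsub>?Q\<^esub> k \<otimes>\<^bsub>?Q\<^esub> f"
    using vc unfolding vc_mod_def by blast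
  obtain r where r: "\<And>U. U \<in> carrier (G Mod N) \<Longrightarrow> r U \<in> carrier G \<and> ?p (r U) = U"
  proof -
    have "\<forall>U\<in>carrier ?Q. \<exists>x. x \<in> carrier G \<and> ?p x = U" by (auto simp: carrier_FactGroup)
    then show thesis using that by metis
  qed
  have "\<exists>n\<in>N. \<exists>k::int. \<exists>f\<in>r ` F. x = n \<otimes>\<^bsub>G\<^esub> r T [^]\<^bsub>G\<^esub> k \<otimes>\<^bsub>G\<^esub> f" if x: "x \<in> carrier G" for x
  proof -
    obtain k :: int and f where h: "f \<in> F"
      "?p x = \<one>\<^bsub>?Q\<^esub> \<otimes>\<^bsub>?Q\<^esub> T [^]\<^bsub>?Q\<^esub> k \<otimes>\<^bsub>?Q\<^esub> f"
      using F(3)[OF p.hom_closed[OF x]] by blast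
    have fc: "f \<in> carrier (G Mod N)" using h(1) F(2) by blast
    have cl: "r T \<in> carrier G" "r f \<in> carrier G" using r[OF T] r[OF fc] by auto
    let ?y = "r T [^]\<^bsub>G\<^esub> k \<otimes>\<^bsub>G\<^esub> r f"
    have "?p x = T [^]\<^bsub>?Q\<^esub> k \<otimes>\<^bsub>?Q\<^esub> f"
      using h(2) H.l_one[OF H.int_pow_closed[OF T]] by simp
    also have "\<dots> = ?p (r T) [^]\<^bsub>?Q\<^esub> k \<otimes>\<^bsub>?Q\<^esub> ?p (r f)" using r[OF T] r[OF fc] by simp
    also have "\<dots> = ?p ?y" using cl by (simp only: p.hom_mult p.hom_int_pow G.int_pow_closed)
    finally have "x \<otimes>\<^bsub>G\<^esub> inv\<^bsub>G\<^esub> ?y \<in> N" using G.rcos_eq_iff[OF N.is_subgroup x, of ?y] cl by simp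
    moreover have "x = (x \<otimes>\<^bsub>G\<^esub> inv\<^bsub>G\<^esub> ?y) \<otimes>\<^bsub>G\<^esub> r T [^]\<^bsub>G\<^esub> k \<otimes>\<^bsub>G\<^esub> r f"
      using x cl by (simp add: G.m_assoc G.inv_mult_group)
    ultimately show ?thesis using h(1) by blast
  qed
  moreover have "r T \<in> carrier G" "finite (r ` F)" "r ` F \<subseteq> carrier G" using r T F(1,2) by auto
  ultimately show ?thesis unfolding vc_mod_def by blast
qed

text \<open>The extension theorem applied to \<open>M/N\<close> in \<open>G/N\<close>.\<close>
lemma vc_mod_step:
  assumes G: "group G" and M: "M \<lhd> G" and N: "N \<lhd> G"
    and comm: "\<And>x y. x \<in> M \<Longrightarrow> y \<in> M \<Longrightarrow> comm_elt G x y \<in> N"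
    and vc: "vc_mod G M" and cov: "vc_cover G (carrier G) P E"
  shows "vc_mod G N"
proof -
  interpret G: group G by (rule G)
  interpret M: normal M G by (rule M)
  interpret N: normal N G by (rule N)
  let ?Q = "G Mod N"
  interpret H: group "G Mod N" by (rule N.factorgroup_is_group)
  let ?p = "\<lambda>x. N #>\<^bsub>G\<^esub> x"
  interpret p: group_hom G "G Mod N" ?p
    by (simp add: group_hom_def group_hom_axioms_def N.r_coset_hom_Mod G H.is_group)
  have A: "?p ` M \<lhd> G Mod N"
    using M.surj_hom_normal_subgroup[OF p.group_hom_axioms] by (simp add: carrier_FactGroup)
  have com: "U \<otimes>\<^bsub>?Q\<^esub> V = V \<otimes>\<^bsub>?Q\<^esub> U" if UV: "U \<in> ?p ` M" "V \<in> ?p ` M" for U V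
  proof -
    obtain x y where xy: "x \<in> M" "y \<in> M" "U = ?p x" "V = ?p y" using UV by auto
    have cl: "x \<in> carrier G" "y \<in> carrier G" using xy M.mem_carrier by auto
    have "(x \<otimes>\<^bsub>G\<^esub> y) \<otimes>\<^bsub>G\<^esub> inv\<^bsub>G\<^esub> (y \<otimes>\<^bsub>G\<^esub> x) \<in> N"
      using comm[OF xy(1,2)] cl by (simp add: comm_elt_def G.inv_mult_group G.m_assoc)
    then have "?p (x \<otimes>\<^bsub>G\<^esub> y) = ?p (y \<otimes>\<^bsub>G\<^esub> x)" using G.rcos_eq_iff[OF N.is_subgroup G.m_closed[OF cl] G.m_closed[OF cl(2,1)]] by blast
    then show ?thesis using cl xy(3,4) by (simp only: p.hom_mult)
  qed
  obtain t F where t: "t \<in> carrier G" and F: "finite F" "F \<subseteq> carrier G"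
    "\<And>x. x \<in> carrier G \<Longrightarrow> \<exists>a\<in>M. \<exists>k::int. \<exists>f\<in>F. x = a \<otimes>\<^bsub>G\<^esub> t [^]\<^bsub>G\<^esub> k \<otimes>\<^bsub>G\<^esub> f"
    using vc unfolding vc_mod_def by blast
  have "\<exists>a\<in>?p ` M. \<exists>k::int. \<exists>f\<in>?p ` F. U = a \<otimes>\<^bsub>?Q\<^esub> ?p t [^]\<^bsub>?Q\<^esub> k \<otimes>\<^bsub>?Q\<^esub> f"
    if U: "U \<in> carrier (G Mod N)" for U
  proof -
    obtain x where x: "x \<in> carrier G" "U = ?p x" using U by (auto simp: carrier_FactGroup)
    obtain a f and k :: int where h: "a \<in> M" "f \<in> F" "x = a \<otimes>\<^bsub>G\<^esub> t [^]\<^bsub>G\<^esub> k \<otimes>\<^bsub>G\<^esub> f" using F(3)[OF x(1)] by blast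
    have "a \<in> carrier G" "f \<in> carrier G" using h M.mem_carrier F(2) by auto
    then have "U = ?p a \<otimes>\<^bsub>?Q\<^esub> ?p t [^]\<^bsub>?Q\<^esub> k \<otimes>\<^bsub>?Q\<^esub> ?p f"
      unfolding x(2) h(3) using t by (simp only: p.hom_mult p.hom_int_pow G.m_closed G.int_pow_closed)
    then show ?thesis using h(1,2) by blast
  qed
  moreover have "finite (?p ` F)" "?p ` F \<subseteq> carrier (G Mod N)" "?p t \<in> carrier (G Mod N)"
    using F(1,2) t by (auto simp: carrier_FactGroup)
  ultimately have "vc_mod (G Mod N) (?p ` M)" unfolding vc_mod_def by blast
  moreover obtain Q where "vc_cover (G Mod N) (carrier (G Mod N)) Q E"
    using vc_cover_quotient[OF G N cov] by blast
  ultimately have "vc_mod (G Mod N) {\<one>\<^bsub>?Q\<^esub>}" using H.abelian_extension_vc[OF A com] by blast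
  then show ?thesis by (rule vc_mod_lift[OF G N])
qed

lemma (in group) lower_central_normal:
  "lower_central G k \<lhd> G \<and> lower_central G (Suc k) \<subseteq> lower_central G k"
proof (induction k)
  have gen: "{comm_elt G x y |x y. x \<in> carrier G \<and> y \<in> N} \<subseteq> carrier G" if "N \<subseteq> carrier G" for N
    using that by (auto simp: comm_elt_def)
  case 0
  have "generate G {comm_elt G x y |x y. x \<in> carrier G \<and> y \<in> carrier G} \<subseteq> carrier G"
    using generate_incl[OF gen] by blast
  then show ?case using normal_self by (simp)
next
  have gen: "{comm_elt G x y |x y. x \<in> carrier G \<and> y \<in> N} \<subseteq> carrier G" if "N \<subseteq> carrier G" for N
    using that by (auto simp: comm_elt_def)
  case (Suc k)
  let ?L = "lower_central G"
  have sub: "?L k \<subseteq> carrier G" "subgroup (?L k) G" using Suc normal_imp_subgroup subgroup.subset by blast+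
  have s: "subgroup (?L (Suc k)) G" using generate_is_subgroup[OF gen[OF sub(1)]] by simp
  have dec: "?L (Suc (Suc k)) \<subseteq> ?L (Suc k)"
    using mono_generate[of "{comm_elt G x y |x y. x \<in> carrier G \<and> y \<in> ?L (Suc k)}"
        "{comm_elt G x y |x y. x \<in> carrier G \<and> y \<in> ?L k}"] Suc
    unfolding lower_central.simps(2)[of G "Suc k"] lower_central.simps(2)[of G k] by blast
  have "x \<otimes> y \<otimes> inv x \<in> ?L (Suc k)" if x: "x \<in> carrier G" and y: "y \<in> ?L (Suc k)" for x y
  proof -
    have yc: "y \<in> carrier G" using subgroup.mem_carrier[OF s y] .
    have "comm_elt G x y \<in> ?L (Suc (Suc k))"
      unfolding lower_central.simps(2)[of G "Suc k"] using x y by (intro generate.incl) blast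
    then have "comm_elt G x y \<otimes> y \<in> ?L (Suc k)" using subgroup.m_closed[OF s] dec y by blast
    moreover have "comm_elt G x y \<otimes> y = x \<otimes> y \<otimes> inv x" using x yc by (simp add: comm_elt_def m_assoc)
    ultimately show ?thesis by simp
  qed
  then show ?case using s dec normal_inv_iff by blast
qed

lemma nilpotent_vc_mod_one:
  assumes nil: "nilpotent_group G" and cov: "vc_cover G (carrier G) P E"
  shows "vc_mod G {\<one>\<^bsub>G\<^esub>}"
proof -
  obtain n where G: "group G" and n: "lower_central G n = {\<one>\<^bsub>G\<^esub>}" using nil by (auto simp: nilpotent_group_def)
  interpret group G by (rule G)
  have "vc_mod G (lower_central G k)" for k
  proof (induction k)
    case 0
    have "\<exists>n\<in>carrier G. \<exists>k::int. \<exists>f\<in>{\<one>\<^bsub>G\<^esub>}. x = n \<otimes>\<^bsub>G\<^esub> \<one>\<^bsub>G\<^esub> [^]\<^bsub>G\<^esub> k \<otimes>\<^bsub>G\<^esub> f" if "x \<in> carrier G" for x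
      using that by auto
    then show ?case unfolding vc_mod_def lower_central.simps(1)
      by (intro bexI[of _ "\<one>\<^bsub>G\<^esub>"] exI[of _ "{\<one>\<^bsub>G\<^esub>}"]) auto
  next
    case (Suc k)
    have L: "lower_central G k \<lhd> G" "lower_central G (Suc k) \<lhd> G" using lower_central_normal by blast+
    have "comm_elt G x y \<in> lower_central G (Suc k)" if "x \<in> lower_central G k" "y \<in> lower_central G k" for x y
      using that subgroup.mem_carrier[OF normal_imp_subgroup[OF L(1)]] by (auto intro!: generate.incl)
    then show ?case by (rule vc_mod_step[OF G L _ Suc cov])
  qed
  then show ?thesis using n by metis
qed

section \<open>Finitely many virtually cyclic subgroups from the resolution\<close>

lemma (in group) cyclic_subgroup_cyclic_group:
  assumes C: "subgroup C G" "t \<in> C" "C = range (\<lambda>z::int. t [^] z)"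
  shows "cyclic_group (G\<lparr>carrier := C\<rparr>)"
proof -
  interpret C: group "G\<lparr>carrier := C\<rparr>" using subgroup.subgroup_is_group[OF C(1) is_group] .
  have pow: "t [^]\<^bsub>G\<lparr>carrier := C\<rparr>\<^esub> z = t [^] z" for z :: int
    using int_pow_consistent[OF C(1,2)] by (rule sym)
  have "carrier (G\<lparr>carrier := C\<rparr>) = range (\<lambda>z::int. t [^]\<^bsub>G\<lparr>carrier := C\<rparr>\<^esub> z)"
    unfolding pow using C(3) by simp
  then show ?thesis unfolding C.cyclic_group using C(2) by (intro bexI[of _ t]) simp_all
qed

lemma (in group) vc_mod_one_imp_virtually_cyclic:
  assumes "vc_mod G {\<one>}"
  shows "virtually_cyclic G"
proof -
  obtain t F where t: "t \<in> carrier G" and F: "finite F" "F \<subseteq> carrier G"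
    "\<And>x. x \<in> carrier G \<Longrightarrow> \<exists>k::int. \<exists>f\<in>F. x = \<one> \<otimes> t [^] k \<otimes> f"
    using assms unfolding vc_mod_def by blast
  let ?C = "range (\<lambda>z::int. t [^] z)"
  have C: "subgroup ?C G" using cyclic_subgroup[OF t] .
  have tC: "t \<in> ?C" using rangeI[of "\<lambda>z::int. t [^] z" 1] t by simp
  have "cyclic_group (G\<lparr>carrier := ?C\<rparr>)" by (rule cyclic_subgroup_cyclic_group[OF C tC refl])
  moreover have "rcosets ?C \<subseteq> (\<lambda>f. ?C #> f) ` F"
  proof
    fix K assume "K \<in> rcosets ?C"
    then obtain x where x: "x \<in> carrier G" "K = ?C #> x" unfolding RCOSETS_def by blast
    obtain k :: int and f where f: "f \<in> F" "x = \<one> \<otimes> t [^] k \<otimes> f" using F(3)[OF x(1)] by blast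
    have fc: "f \<in> carrier G" using f(1) F(2) by blast
    have "x \<otimes> inv f = t [^] k" using f(2) fc t by (simp add: m_assoc)
    then have "?C #> x = ?C #> f" using rcos_eq_iff[OF C x(1) fc] by simp
    then show "K \<in> (\<lambda>f. ?C #> f) ` F" using x(2) f(1) by blast
  qed
  then have "finite (rcosets ?C)" using F(1) finite_surj by blast
  ultimately show ?thesis using C is_group unfolding virtually_cyclic_def by blast
qed

text \<open>With \<open>r\<close> the index of the cyclic subgroup, two of the elements \<open>x\<^sup>0, \<dots>, x\<^sup>r\<close> lie in the same
  coset; so \<open>n = r!\<close> works for all \<open>x\<close>.\<close>
lemma virtually_cyclic_elements:
  assumes vc: "virtually_cyclic G"
  shows "\<exists>c\<in>carrier G. \<exists>F. \<exists>n::nat. finite F \<and> F \<subseteq> carrier G \<and> 0 < n \<and>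
    (\<forall>x\<in>carrier G. \<exists>f\<in>F. \<exists>(z::int) (y::int). x = c [^]\<^bsub>G\<^esub> z \<otimes>\<^bsub>G\<^esub> f \<and> x [^]\<^bsub>G\<^esub> n = c [^]\<^bsub>G\<^esub> y)"
proof -
  obtain C where G: "group G" and C: "subgroup C G" and cyc: "cyclic_group (G\<lparr>carrier := C\<rparr>)"
    and fin: "finite (rcosets\<^bsub>G\<^esub> C)" using vc unfolding virtually_cyclic_def by blast
  interpret G: group G by (rule G)
  interpret C: group "G\<lparr>carrier := C\<rparr>" using subgroup.subgroup_is_group[OF C G] .
  obtain c where "c \<in> C" "C = range (\<lambda>z::int. c [^]\<^bsub>G\<lparr>carrier := C\<rparr>\<^esub> z)"
    using cyc unfolding C.cyclic_group by auto
  then have c: "c \<in> C" "C = range (\<lambda>z::int. c [^]\<^bsub>G\<^esub> z)" using G.int_pow_consistent[OF C] by auto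
  have cc: "c \<in> carrier G" using subgroup.mem_carrier[OF C c(1)] .
  define n :: nat where "n = fact (card (rcosets\<^bsub>G\<^esub> C))"
  define r where "r K = (SOME x. x \<in> K)" for K :: "'a set"
  have rK: "r (C #>\<^bsub>G\<^esub> x) \<in> C #>\<^bsub>G\<^esub> x" if "x \<in> carrier G" for x
    unfolding r_def using G.rcos_self[OF that C] by (rule someI)
  have rc: "r (C #>\<^bsub>G\<^esub> x) \<in> carrier G" if "x \<in> carrier G" for x
    using rK[OF that] G.r_coset_subset_G[OF subgroup.subset[OF C] that] by blast
  have cos: "C #>\<^bsub>G\<^esub> x \<in> rcosets\<^bsub>G\<^esub> C" if "x \<in> carrier G" for x
    using G.rcosetsI[OF subgroup.subset[OF C] that] .
  have "\<exists>f\<in>r ` (rcosets\<^bsub>G\<^esub> C). \<exists>(z::int) (y::int). x = c [^]\<^bsub>G\<^esub> z \<otimes>\<^bsub>G\<^esub> f \<and> x [^]\<^bsub>G\<^esub> n = c [^]\<^bsub>G\<^esub> y"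
    if x: "x \<in> carrier G" for x
  proof -
    let ?f = "r (C #>\<^bsub>G\<^esub> x)"
    have "C #>\<^bsub>G\<^esub> x = C #>\<^bsub>G\<^esub> ?f" using G.repr_independence[OF rK[OF x] x C] .
    then have "x \<otimes>\<^bsub>G\<^esub> inv\<^bsub>G\<^esub> ?f \<in> C" using G.rcos_eq_iff[OF C x rc[OF x]] by blast
    then obtain z :: int where z: "x \<otimes>\<^bsub>G\<^esub> inv\<^bsub>G\<^esub> ?f = c [^]\<^bsub>G\<^esub> z" using c(2) by blast
    have "x = (x \<otimes>\<^bsub>G\<^esub> inv\<^bsub>G\<^esub> ?f) \<otimes>\<^bsub>G\<^esub> ?f" using x rc[OF x] by (simp add: G.m_assoc)
    then have 1: "x = c [^]\<^bsub>G\<^esub> z \<otimes>\<^bsub>G\<^esub> ?f" unfolding z .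
    let ?h = "\<lambda>i::nat. C #>\<^bsub>G\<^esub> (x [^]\<^bsub>G\<^esub> i)"
    have "\<not> inj_on ?h {..card (rcosets\<^bsub>G\<^esub> C)}"
    proof
      assume "inj_on ?h {..card (rcosets\<^bsub>G\<^esub> C)}"
      then have "card {..card (rcosets\<^bsub>G\<^esub> C)} \<le> card (rcosets\<^bsub>G\<^esub> C)"
        by (rule card_inj_on_le) (use cos x fin in auto)
      then show False by simp
    qed
    then obtain i j where ij: "i < j" "j \<le> card (rcosets\<^bsub>G\<^esub> C)" "?h i = ?h j"
      unfolding inj_on_def by (metis atMost_iff linorder_neqE_nat)
    have "x [^]\<^bsub>G\<^esub> j \<otimes>\<^bsub>G\<^esub> inv\<^bsub>G\<^esub> (x [^]\<^bsub>G\<^esub> i) \<in> C"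
      using G.rcos_eq_iff[OF C, of "x [^]\<^bsub>G\<^esub> j" "x [^]\<^bsub>G\<^esub> i"] ij(3) x by simp
    moreover have "x [^]\<^bsub>G\<^esub> j = x [^]\<^bsub>G\<^esub> (j - i) \<otimes>\<^bsub>G\<^esub> x [^]\<^bsub>G\<^esub> i" using x ij(1) by (simp add: G.nat_pow_mult)
    ultimately have pC: "x [^]\<^bsub>G\<^esub> (j - i) \<in> C" using x by (simp add: G.m_assoc)
    have "j - i dvd n" unfolding n_def using ij by (intro dvd_fact) auto
    then obtain q where "n = (j - i) * q" by auto
    then have "x [^]\<^bsub>G\<^esub> n = (x [^]\<^bsub>G\<^esub> (j - i)) [^]\<^bsub>G\<^esub> int q" using x by (simp add: G.nat_pow_pow int_pow_int)
    then have "x [^]\<^bsub>G\<^esub> n \<in> C" using G.subgroup_int_pow_closed[OF C pC] by simp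
    then obtain y :: int where 2: "x [^]\<^bsub>G\<^esub> n = c [^]\<^bsub>G\<^esub> y" using c(2) by blast
    show ?thesis using 1 2 cos[OF x] by blast
  qed
  moreover have "finite (r ` (rcosets\<^bsub>G\<^esub> C))" using fin by simp
  moreover have "r ` (rcosets\<^bsub>G\<^esub> C) \<subseteq> carrier G" using rc by (auto simp: RCOSETS_def)
  moreover have "0 < n" by (simp add: n_def)
  ultimately show ?thesis using cc by blast
qed

context group
begin

lemma cyclic_mem_VC:
  assumes w: "w \<in> carrier G"
  shows "range (\<lambda>z::int. w [^] z) \<in> VC G"
proof -
  define C where "C = range (\<lambda>z::int. w [^] z)"
  have C: "subgroup C G" using cyclic_subgroup[OF w] by (simp add: C_def)
  have wC: "w \<in> C" using rangeI[of "\<lambda>z::int. w [^] z" 1] w by (simp add: C_def)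
  interpret H: group "G\<lparr>carrier := C\<rparr>" using subgroup.subgroup_is_group[OF C is_group] .
  have "rcosets\<^bsub>G\<lparr>carrier := C\<rparr>\<^esub> C \<subseteq> {C}"
    using coset_join2[OF subgroup.mem_carrier[OF C] C] by (auto simp: RCOSETS_def)
  then have "finite (rcosets\<^bsub>G\<lparr>carrier := C\<rparr>\<^esub> C)" using finite_subset by blast
  moreover have "subgroup C (G\<lparr>carrier := C\<rparr>)" using H.subgroup_self by simp
  moreover have "cyclic_group (G\<lparr>carrier := C, carrier := C\<rparr>)"
    using cyclic_subgroup_cyclic_group[OF C wC C_def] by simp
  ultimately have "virtually_cyclic (G\<lparr>carrier := C\<rparr>)" using H.is_group unfolding virtually_cyclic_def by blast
  then show ?thesis using C by (simp add: VC_def C_def)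
qed

definition coset_action :: "'a set \<Rightarrow> ('a, 'a set) gset" where
  "coset_action C = ((\<lambda>y. y <# C) ` carrier G, \<lambda>g. \<lambda>K \<in> (\<lambda>y. y <# C) ` carrier G. g <# K)"

lemma coset_action_apply:
  assumes C: "subgroup C G" and g: "g \<in> carrier G" "y \<in> carrier G"
  shows "snd (coset_action C) g (y <# C) = (g \<otimes> y) <# C"
  using lcos_m_assoc[OF subgroup.subset[OF C] g] g by (auto simp: coset_action_def)

lemma coset_action_transitive:
  assumes C: "subgroup C G"
  shows "transitive_action G (fst (coset_action C)) (snd (coset_action C))"
proof -
  let ?E = "fst (coset_action C)" and ?\<phi> = "snd (coset_action C)"
  have E: "?E = (\<lambda>y. y <# C) ` carrier G" by (simp add: coset_action_def)
  have app: "?\<phi> g (y <# C) = (g \<otimes> y) <# C" if "g \<in> carrier G" "y \<in> carrier G" for g y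
    using coset_action_apply[OF C that] .
  have ext: "?\<phi> g \<in> extensional ?E" for g by (simp add: coset_action_def)
  have bij: "?\<phi> g \<in> Bij ?E" if g: "g \<in> carrier G" for g
  proof -
    have "bij_betw (?\<phi> g) ?E ?E"
      by (rule bij_betw_byWitness[where f' = "?\<phi> (inv g)"]) (use g in \<open>auto simp: E app\<close>)
    then show ?thesis using ext by (simp add: Bij_def)
  qed
  have "?\<phi> (g \<otimes> h) = compose ?E (?\<phi> g) (?\<phi> h)" if gh: "g \<in> carrier G" "h \<in> carrier G" for g h
  proof (rule extensionalityI[OF ext])
    show "compose ?E (?\<phi> g) (?\<phi> h) \<in> extensional ?E" by (rule compose_extensional)
  next
    fix K assume K: "K \<in> ?E"
    then obtain y where y: "y \<in> carrier G" "K = y <# C" unfolding E by blast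
    show "?\<phi> (g \<otimes> h) K = compose ?E (?\<phi> g) (?\<phi> h) K"
      unfolding compose_eq[OF K] using y gh by (simp add: app m_assoc)
  qed
  then have "group_hom G (BijGroup ?E) ?\<phi>"
    unfolding group_hom_def group_hom_axioms_def hom_def
    using bij group_BijGroup is_group by (auto simp: BijGroup_def)
  moreover have "\<exists>g\<in>carrier G. ?\<phi> g K = K'" if KK: "K \<in> ?E" "K' \<in> ?E" for K K'
  proof -
    obtain y y' where y: "y \<in> carrier G" "K = y <# C" "y' \<in> carrier G" "K' = y' <# C"
      using KK unfolding E by blast
    then have "?\<phi> (y' \<otimes> inv y) K = K'" by (simp add: app m_assoc)
    then show ?thesis using y by blast
  qed
  ultimately show ?thesis
    by (simp add: transitive_action_def transitive_action_axioms_def group_action_def)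
qed

lemma coset_action_stabilizer:
  assumes C: "subgroup C G" and y: "y \<in> carrier G"
  shows "stabilizer G (snd (coset_action C)) (y <# C) = conjugated G y ` C"
proof (intro equalityI subsetI)
  note Cs = subgroup.subset[OF C]
  fix g assume "g \<in> stabilizer G (snd (coset_action C)) (y <# C)"
  then have g: "g \<in> carrier G" "(g \<otimes> y) <# C = y <# C"
    using coset_action_apply[OF C _ y] by (auto simp: stabilizer_def)
  have "g \<otimes> y \<in> (g \<otimes> y) <# C"
    using subgroup.one_closed[OF C] g(1) y by (force simp: l_coset_def)
  then obtain c where c: "c \<in> C" "g \<otimes> y = y \<otimes> c" using g(2) by (auto simp: l_coset_def)
  then have "conjugated G y c = g" using g(1) y Cs by (auto simp: conjugated_def m_assoc dest: sym[of "g \<otimes> y"])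
  then show "g \<in> conjugated G y ` C" using c(1) by blast
next
  note Cs = subgroup.subset[OF C]
  fix g assume "g \<in> conjugated G y ` C"
  then obtain c where c: "c \<in> C" "g = conjugated G y c" by blast
  have cc: "c \<in> carrier G" using c(1) Cs by blast
  have "g \<otimes> y = y \<otimes> c" using c(2) cc y by (simp add: conjugated_def m_assoc)
  then have "(g \<otimes> y) <# C = y <# (c <# C)" using lcos_m_assoc[OF Cs y cc] by simp
  also have "c <# C = C" using coset_join3[OF cc C c(1)] .
  finally show "g \<in> stabilizer G (snd (coset_action C)) (y <# C)"
    using coset_action_apply[OF C _ y] c(2) cc y by (simp add: stabilizer_def)
qed

lemma cyclic_coset_object:
  assumes x: "x \<in> carrier G"
  shows "coset_action (range (\<lambda>z::int. x [^] z)) \<in> orb_objects G (VC G)"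
proof -
  let ?C = "range (\<lambda>z::int. x [^] z)"
  have C: "subgroup ?C G" using cyclic_subgroup[OF x] .
  have tr: "transitive_action G (fst (coset_action ?C)) (snd (coset_action ?C))"
    using coset_action_transitive[OF C] .
  have "stabilizer G (snd (coset_action ?C)) K \<in> VC G" if K: "K \<in> fst (coset_action ?C)" for K
  proof -
    obtain y where y: "y \<in> carrier G" "K = y <# ?C" using K by (auto simp: coset_action_def)
    have "conjugated G y ` ?C = range (\<lambda>z::int. conjugated G y x [^] z)"
      using conjugated_int_pow[OF y(1) x] by (auto simp: image_image)
    then show ?thesis
      unfolding y(2) coset_action_stabilizer[OF C y(1)] using cyclic_mem_VC[of "conjugated G y x"] x y(1) by simp
  qed
  then show ?thesis
    using tr by (auto simp: orb_objects_def gset_over_def transitive_action_def coset_action_def)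
qed

end

text \<open>Without \<open>G\<close>-maps \<open>\<Delta> \<rightarrow> \<Omega>\<close> the value of \<open>\<int>[-,\<Omega>]\<close> at \<open>\<Delta>\<close> is trivial; hence so is that of its
  summand \<open>P\<close>, which cannot map onto \<open>\<int>\<close>.\<close>
lemma free_cover_gmaps_nonempty:
  assumes epi: "orb_epi G \<F> P const_Z \<epsilon>"
    and iso: "orb_isomorphic G \<F> (orb_sum P Q) (free_orb_module G \<Omega>)"
    and Q: "is_orb_module G \<F> Q" and D: "\<Delta> \<in> orb_objects G \<F>"
  shows "gmaps G \<Delta> \<Omega> \<noteq> {}"
proof
  assume empty: "gmaps G \<Delta> \<Omega> = {}"
  obtain \<eta> where "\<eta> \<in> iso (ob (orb_sum P Q) \<Delta>) (ob (free_orb_module G \<Omega>) \<Delta>)"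
    using iso D unfolding orb_isomorphic_def by blast
  then have bij: "bij_betw \<eta> (carrier (ob P \<Delta>) \<times> carrier (ob Q \<Delta>)) (carrier (free_Abelian_group (gmaps G \<Delta> \<Omega>)))"
    by (simp add: iso_def orb_sum_def free_orb_module_def)
  have zero: "carrier (free_Abelian_group (gmaps G \<Delta> \<Omega>)) \<subseteq> {0}" unfolding empty by auto
  have "comm_group (ob Q \<Delta>)" using Q D by (simp add: is_orb_module_def)
  then interpret Q: comm_group "ob Q \<Delta>" .
  have sur: "\<epsilon> \<Delta> ` carrier (ob P \<Delta>) = UNIV"
    using epi D by (simp add: orb_epi_def const_Z_def)
  then obtain p q where pq: "p \<in> carrier (ob P \<Delta>)" "q \<in> carrier (ob P \<Delta>)" "\<epsilon> \<Delta> p = (0::int)" "\<epsilon> \<Delta> q = 1"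
    by (metis UNIV_I imageE)
  have trivial: "\<eta> u = 0" if "u \<in> carrier (ob P \<Delta>) \<times> carrier (ob Q \<Delta>)" for u
    using bij_betw_apply[OF bij that] zero by (rule subsetD[THEN singletonD, rotated])
  have mem: "(p, \<one>\<^bsub>ob Q \<Delta>\<^esub>) \<in> carrier (ob P \<Delta>) \<times> carrier (ob Q \<Delta>)"
    "(q, \<one>\<^bsub>ob Q \<Delta>\<^esub>) \<in> carrier (ob P \<Delta>) \<times> carrier (ob Q \<Delta>)" using pq by simp_all
  have "(p, \<one>\<^bsub>ob Q \<Delta>\<^esub>) = (q, \<one>\<^bsub>ob Q \<Delta>\<^esub>)"
    by (rule inj_onD[OF bij_betw_imp_inj_on[OF bij] _ mem]) (simp only: trivial mem)
  then have "p = q" by simp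
  then show False using pq by simp
qed

text \<open>A \<open>G\<close>-map from \<open>G/\<langle>x\<rangle>\<close> to \<open>\<Omega>\<close> sends the coset \<open>\<langle>x\<rangle>\<close> to a point fixed by \<open>x\<close>. So every \<open>x\<close>
  lies in the stabiliser of a point of \<open>\<Omega>\<close>, which is conjugate to the stabiliser of one of
  finitely many orbit representatives.\<close>
lemma bredon_FP0_imp_vc_cover:
  assumes G: "group G" and FP: "bredon_FP G (VC G) n"
  shows "\<exists>P E. vc_cover G (carrier G) P E"
proof -
  interpret group G by (rule G)
  obtain P d \<epsilon> where res: "projective_resolution_Z G (VC G) P d \<epsilon>" and fg: "fin_gen_projective G (VC G) (P 0)"
    using FP unfolding bredon_FP_def by blast
  have epi: "orb_epi G (VC G) (P 0) const_Z \<epsilon>" using res by (simp add: projective_resolution_Z_def)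
  obtain \<Omega> :: "('a, nat \<times> 'a set) gset" and Q :: "('a, 'a univ) orb_module" where
    \<Omega>: "gset_over G (VC G) \<Omega>" "finite (orbits G (fst \<Omega>) (snd \<Omega>))" and Q: "is_orb_module G (VC G) Q"
    and iso: "orb_isomorphic G (VC G) (orb_sum (P 0) Q) (free_orb_module G \<Omega>)"
    using fg unfolding fin_gen_projective_def by blast
  let ?\<phi> = "snd \<Omega>"
  interpret \<Omega>: group_action G "fst \<Omega>" ?\<phi> using \<Omega>(1) by (simp add: gset_over_def)
  define R where "R = (\<lambda>S. SOME r. r \<in> fst \<Omega> \<and> S = orbit G ?\<phi> r) ` orbits G (fst \<Omega>) ?\<phi>"
  have finR: "finite R" unfolding R_def using \<Omega>(2) by simp
  have sel: "(SOME r. r \<in> fst \<Omega> \<and> S = orbit G ?\<phi> r) \<in> fst \<Omega> \<and> S = orbit G ?\<phi> (SOME r. r \<in> fst \<Omega> \<and> S = orbit G ?\<phi> r)"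
    if "S \<in> orbits G (fst \<Omega>) ?\<phi>" for S
    by (rule someI_ex) (use that in \<open>auto simp: orbits_def\<close>)
  have R: "R \<subseteq> fst \<Omega>" unfolding R_def using sel by blast
  have reps: "\<exists>r\<in>R. \<exists>g\<in>carrier G. \<omega> = ?\<phi> g r" if w: "\<omega> \<in> fst \<Omega>" for \<omega>
  proof -
    have S: "orbit G ?\<phi> \<omega> \<in> orbits G (fst \<Omega>) ?\<phi>" unfolding orbits_def using w by blast
    define r where "r = (SOME r. r \<in> fst \<Omega> \<and> orbit G ?\<phi> \<omega> = orbit G ?\<phi> r)"
    have "r \<in> R" unfolding R_def r_def using S by blast
    moreover have "\<omega> \<in> orbit G ?\<phi> r" using sel[OF S] \<Omega>.orbit_refl[OF w] unfolding r_def by simp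
    ultimately show ?thesis by (auto simp: orbit_def)
  qed
  have "\<exists>c\<in>carrier G. \<exists>F. \<exists>n::nat. finite F \<and> F \<subseteq> carrier G \<and> 0 < n \<and>
    (\<forall>x\<in>stabilizer G ?\<phi> r. \<exists>f\<in>F. \<exists>(z::int) (y::int). x = c [^]\<^bsub>G\<^esub> z \<otimes>\<^bsub>G\<^esub> f \<and> x [^]\<^bsub>G\<^esub> n = c [^]\<^bsub>G\<^esub> y)"
    if r: "r \<in> R" for r
  proof -
    let ?H = "stabilizer G ?\<phi> r"
    have "?H \<in> VC G" using \<Omega>(1) r R by (auto simp: gset_over_def)
    then have H: "subgroup ?H G" "virtually_cyclic (G\<lparr>carrier := ?H\<rparr>)" by (auto simp: VC_def)
    obtain c F and n :: nat where h: "c \<in> ?H" "finite F" "F \<subseteq> ?H" "0 < n"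
      "\<And>x. x \<in> ?H \<Longrightarrow> \<exists>f\<in>F. \<exists>(z::int) (y::int). x = c [^]\<^bsub>G\<lparr>carrier := ?H\<rparr>\<^esub> z \<otimes>\<^bsub>G\<^esub> f \<and>
          x [^]\<^bsub>G\<lparr>carrier := ?H\<rparr>\<^esub> n = c [^]\<^bsub>G\<lparr>carrier := ?H\<rparr>\<^esub> y"
      using virtually_cyclic_elements[OF H(2)] by auto
    have 1: "c [^]\<^bsub>G\<lparr>carrier := ?H\<rparr>\<^esub> z = c [^]\<^bsub>G\<^esub> z" for z :: int using int_pow_consistent[OF H(1) h(1)] by simp
    have 2: "x [^]\<^bsub>G\<lparr>carrier := ?H\<rparr>\<^esub> n = x [^]\<^bsub>G\<^esub> n" for x using nat_pow_consistent[of x n ?H] by simp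
    have "c \<in> carrier G" "F \<subseteq> carrier G" using h(1,3) subgroup.subset[OF H(1)] by blast+
    then show ?thesis using h(2,4,5) unfolding 1 2 by blast
  qed
  then obtain c F n where cFn: "\<And>r. r \<in> R \<Longrightarrow> c r \<in> carrier G \<and> finite (F r) \<and> F r \<subseteq> carrier G \<and> 0 < (n r :: nat) \<and>
    (\<forall>x\<in>stabilizer G ?\<phi> r. \<exists>f\<in>F r. \<exists>(z::int) (y::int). x = c r [^]\<^bsub>G\<^esub> z \<otimes>\<^bsub>G\<^esub> f \<and> x [^]\<^bsub>G\<^esub> n r = c r [^]\<^bsub>G\<^esub> y)"
    by metis
  define E where "E = (\<Prod>r\<in>R. n r)"
  define S where "S = (\<Union>r\<in>R. (\<lambda>f. (c r, f)) ` F r)"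
  have E: "0 < E" unfolding E_def using cFn by (intro prod_pos) blast
  have S: "finite S" "S \<subseteq> carrier G \<times> carrier G" unfolding S_def using finR cFn by (simp, blast)
  have "\<exists>(c, f)\<in>S. \<exists>g\<in>carrier G. \<exists>(z::int) (y::int).
        x = conjugated G g (c [^]\<^bsub>G\<^esub> z \<otimes>\<^bsub>G\<^esub> f) \<and> x [^]\<^bsub>G\<^esub> E = conjugated G g (c [^]\<^bsub>G\<^esub> y)"
    if x: "x \<in> carrier G" for x
  proof -
    let ?C = "range (\<lambda>z::int. x [^]\<^bsub>G\<^esub> z)"
    have C: "subgroup ?C G" using cyclic_subgroup[OF x] .
    have xC: "x \<in> ?C" using rangeI[of "\<lambda>z::int. x [^]\<^bsub>G\<^esub> z" 1] x by simp
    let ?\<Delta> = "coset_action ?C"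
    obtain m where m: "m \<in> gmaps G ?\<Delta> \<Omega>"
      using free_cover_gmaps_nonempty[OF epi iso Q cyclic_coset_object[OF x]] by blast
    have K: "\<one>\<^bsub>G\<^esub> <#\<^bsub>G\<^esub> ?C \<in> fst ?\<Delta>" by (auto simp: coset_action_def)
    let ?\<omega> = "m (\<one>\<^bsub>G\<^esub> <#\<^bsub>G\<^esub> ?C)"
    have w: "?\<omega> \<in> fst \<Omega>" using m K by (auto simp: gmaps_def)
    have "x \<in> stabilizer G (snd ?\<Delta>) (\<one>\<^bsub>G\<^esub> <#\<^bsub>G\<^esub> ?C)"
      unfolding coset_action_stabilizer[OF C one_closed] using xC x by (intro image_eqI[of _ _ x]) simp_all
    then have "snd ?\<Delta> x (\<one>\<^bsub>G\<^esub> <#\<^bsub>G\<^esub> ?C) = \<one>\<^bsub>G\<^esub> <#\<^bsub>G\<^esub> ?C" by (simp add: stabilizer_def)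
    moreover have "m (snd ?\<Delta> x (\<one>\<^bsub>G\<^esub> <#\<^bsub>G\<^esub> ?C)) = ?\<phi> x ?\<omega>" using m K x unfolding gmaps_def by blast
    ultimately have fix_w: "?\<phi> x ?\<omega> = ?\<omega>" by simp
    obtain r g where rg: "r \<in> R" "g \<in> carrier G" "?\<omega> = ?\<phi> g r" using reps[OF w] by blast
    have rE: "r \<in> fst \<Omega>" using rg(1) R by blast
    define u where "u = conjugated G (inv\<^bsub>G\<^esub> g) x"
    have u: "u \<in> carrier G" "conjugated G g u = x" using rg(2) x by (auto simp: u_def)
    have "u = inv\<^bsub>G\<^esub> g \<otimes>\<^bsub>G\<^esub> (x \<otimes>\<^bsub>G\<^esub> g)" using rg(2) x by (simp add: u_def conjugated_def m_assoc)
    then have "?\<phi> u r = ?\<phi> (inv\<^bsub>G\<^esub> g) (?\<phi> (x \<otimes>\<^bsub>G\<^esub> g) r)"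
      using \<Omega>.composition_rule[OF rE inv_closed[OF rg(2)] m_closed[OF x rg(2)]] by simp
    also have "?\<phi> (x \<otimes>\<^bsub>G\<^esub> g) r = ?\<phi> x (?\<phi> g r)" by (rule \<Omega>.composition_rule[OF rE x rg(2)])
    also have "?\<phi> (inv\<^bsub>G\<^esub> g) (?\<phi> x (?\<phi> g r)) = r" using fix_w \<Omega>.orbit_sym_aux[OF rg(2) rE] rg(3) by simp
    finally have "u \<in> stabilizer G ?\<phi> r" using u(1) by (simp add: stabilizer_def)
    then obtain f and z y :: int where h: "f \<in> F r" "u = c r [^]\<^bsub>G\<^esub> z \<otimes>\<^bsub>G\<^esub> f" "u [^]\<^bsub>G\<^esub> n r = c r [^]\<^bsub>G\<^esub> y"
      using cFn[OF rg(1)] by blast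
    have cr: "c r \<in> carrier G" using cFn[OF rg(1)] by blast
    have "n r dvd E" unfolding E_def using rg(1) finR by (simp add: dvd_prod_eqI)
    then obtain q where q: "E = n r * q" by auto
    have "x [^]\<^bsub>G\<^esub> E = conjugated G g (u [^]\<^bsub>G\<^esub> E)" using conjugated_nat_pow[OF rg(2) u(1)] u(2) by simp
    also have "u [^]\<^bsub>G\<^esub> E = (u [^]\<^bsub>G\<^esub> n r) [^]\<^bsub>G\<^esub> int q" using u(1) by (simp add: q nat_pow_pow int_pow_int)
    also have "\<dots> = c r [^]\<^bsub>G\<^esub> (y * int q)" using cr by (simp add: h(3) int_pow_pow)
    finally have 2: "x [^]\<^bsub>G\<^esub> E = conjugated G g (c r [^]\<^bsub>G\<^esub> (y * int q))" .
    have 1: "x = conjugated G g (c r [^]\<^bsub>G\<^esub> z \<otimes>\<^bsub>G\<^esub> f)" using u(2) h(2) by simp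
    have mem: "(c r, f) \<in> S" unfolding S_def using rg(1) h(1) by blast
    have "\<exists>g\<in>carrier G. \<exists>(z::int) (y::int). x = conjugated G g (c r [^]\<^bsub>G\<^esub> z \<otimes>\<^bsub>G\<^esub> f) \<and>
        x [^]\<^bsub>G\<^esub> E = conjugated G g (c r [^]\<^bsub>G\<^esub> y)"
      by (rule bexI[OF _ rg(2)], rule exI, rule exI, rule conjI, rule 1, rule 2)
    then show ?thesis by (intro bexI[OF _ mem]) (simp only: case_prod_conv)
  qed
  then have "vc_cover G (carrier G) S E" unfolding vc_cover_def using S E by blast
  then show ?thesis by blast
qed

theorem theorem5p2:
  fixes G :: "('a, 'b) monoid_scheme"
  assumes "group G"
    and "abelian_by_nilpotent G"
    and "bredon_FP G (VC G) 1"
    and "\<And>g. g \<in> carrier G \<Longrightarrow> group.ord G g = 0 \<Longrightarrow> fin_gen_subgroup G (centralizer G g)"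
  shows "virtually_cyclic G"
proof -
  interpret group G by (rule assms(1))
  obtain P E where cov: "vc_cover G (carrier G) P E"
    using bredon_FP0_imp_vc_cover[OF assms(1,3)] by blast
  obtain A where A: "A \<lhd> G" and comm: "comm_group (G\<lparr>carrier := A\<rparr>)" and nil: "nilpotent_group (G Mod A)"
    using assms(2) unfolding abelian_by_nilpotent_def by blast
  obtain Q where "vc_cover (G Mod A) (carrier (G Mod A)) Q E"
    using vc_cover_quotient[OF assms(1) A cov] by blast
  then have "vc_mod (G Mod A) {\<one>\<^bsub>G Mod A\<^esub>}" by (rule nilpotent_vc_mod_one[OF nil])
  then have "vc_mod G A" by (rule vc_mod_lift[OF assms(1) A])
  moreover have "x \<otimes>\<^bsub>G\<^esub> y = y \<otimes>\<^bsub>G\<^esub> x" if "x \<in> A" "y \<in> A" for x y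
    using comm_monoid.m_comm[OF comm_group.axioms(1)[OF comm], of x y] that by simp
  ultimately have "vc_mod G {\<one>\<^bsub>G\<^esub>}" using abelian_extension_vc[OF A _ _ cov] by blast
  then show ?thesis by (rule vc_mod_one_imp_virtually_cyclic)
qed

end
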